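(* There is an algorithm that, given a width-stable DAG $G$ (with single source $s$ and single sink $t$) and a non-negative integer flow $f$ on $G$, outputs a flow decomposition of $(G,f)$ with non-negative integer weights whose size is at most $(\lfloor\log\Vert f\Vert\rfloor+1)\cdot \mathrm{MFD}_{\mathbb{N}}(G,f)$, in time $O(n\log\Vert f\Vert\cdot(\mathrm{width}(G)+m))$.
   Context: All graphs are directed acyclic multigraphs with a single source $s$ and single sink $t$, every edge lying on some $s$-$t$ path; $n=|V(G)|$, $m=|E(G)|$. A flow is $f:E(G)\to\mathbb{N}$ with conservation at all vertices other than $s,t$; $\Vert f\Vert=\max_e f(e)$; $\log$ is base 2. A flow decomposition of size $k$ of $(G,f)$ is a family of $s$-$t$ paths $P_1,\dots,P_k$ with weights $w_1,\dots,w_k\in\mathbb{N}$ such that $f=\sum_i w_iP_i$ (paths identified with indicator functions on edges). $\mathrm{MFD}_{\mathbb{N}}(G,f)$ is the minimum size of such a decomposition. $\mathrm{width}(G)$ is the minimum number of $s$-$t$ paths needed to cover all edges of $G$. For a flow $f$, the flow-subgraph $G|_f$ has edge set $\{e: f(e)>0\}$ and vertex set consisting of the vertices with positive incoming or outgoing flow. $G$ is width-stable if $\mathrm{width}(G|_f)\le \mathrm{width}(G|_g)$ for all non-negative integer flows $0\le f\le g$ (pointwise on edges). *)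

theory Defs
  imports Complex_Main "Graph_Theory.Graph_Theory"
begin

section \<open>Flows and flow decompositions\<close>

definition st_dag :: "('v, 'e) pre_digraph \<Rightarrow> 'v \<Rightarrow> 'v \<Rightarrow> bool" where
  "st_dag G s t \<longleftrightarrow>
     fin_digraph G \<and>
     (\<nexists>c. pre_digraph.cycle G c) \<and>
     {v \<in> verts G. in_degree G v = 0} = {s} \<and>
     {v \<in> verts G. out_degree G v = 0} = {t} \<and>
     (\<forall>e \<in> arcs G. \<exists>p. pre_digraph.apath G s p t \<and> e \<in> set p)"

definition is_flow :: "('v, 'e) pre_digraph \<Rightarrow> 'v \<Rightarrow> 'v \<Rightarrow> ('e \<Rightarrow> nat) \<Rightarrow> bool" where
  "is_flow G s t f \<longleftrightarrow>
     (\<forall>v \<in> verts G - {s, t}. (\<Sum>e \<in> in_arcs G v. f e) = (\<Sum>e \<in> out_arcs G v. f e))"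

text \<open>The inserted \<open>0\<close> only matters for a graph without arcs.\<close>

definition flow_norm :: "('v, 'e) pre_digraph \<Rightarrow> ('e \<Rightarrow> nat) \<Rightarrow> nat" where
  "flow_norm G f = Max (insert 0 (f ` arcs G))"

definition flow_decomposition ::
    "('v, 'e) pre_digraph \<Rightarrow> 'v \<Rightarrow> 'v \<Rightarrow> ('e \<Rightarrow> nat) \<Rightarrow> (nat \<times> 'e list) list \<Rightarrow> bool" where
  "flow_decomposition G s t f D \<longleftrightarrow>
     (\<forall>(w, p) \<in> set D. pre_digraph.apath G s p t) \<and>
     (\<forall>e \<in> arcs G. f e = (\<Sum>(w, p) \<leftarrow> D. w * of_bool (e \<in> set p)))"

definition mfd :: "('v, 'e) pre_digraph \<Rightarrow> 'v \<Rightarrow> 'v \<Rightarrow> ('e \<Rightarrow> nat) \<Rightarrow> nat" where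
  "mfd G s t f = (LEAST k. \<exists>D. flow_decomposition G s t f D \<and> length D = k)"

definition width :: "('v, 'e) pre_digraph \<Rightarrow> 'v \<Rightarrow> 'v \<Rightarrow> nat" where
  "width G s t =
     (LEAST k. \<exists>ps. (\<forall>p \<in> set ps. pre_digraph.apath G s p t) \<and>
                    arcs G \<subseteq> (\<Union>p \<in> set ps. set p) \<and> length ps = k)"

definition flow_subgraph :: "('v, 'e) pre_digraph \<Rightarrow> ('e \<Rightarrow> nat) \<Rightarrow> ('v, 'e) pre_digraph" where
  "flow_subgraph G f =
     \<lparr> verts = {v \<in> verts G. (\<Sum>e \<in> in_arcs G v. f e) > 0 \<or> (\<Sum>e \<in> out_arcs G v. f e) > 0},
       arcs = {e \<in> arcs G. f e > 0},
       tail = tail G, head = head G \<rparr>"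

definition width_stable :: "('v, 'e) pre_digraph \<Rightarrow> 'v \<Rightarrow> 'v \<Rightarrow> bool" where
  "width_stable G s t \<longleftrightarrow>
     (\<forall>f g. is_flow G s t f \<and> is_flow G s t g \<and> (\<forall>e \<in> arcs G. f e \<le> g e) \<longrightarrow>
        width (flow_subgraph G f) s t \<le> width (flow_subgraph G g) s t)"

section \<open>Model of computation\<close>

text \<open>
  A unit-cost random access machine with structured control flow. The memory consists of named,
  unbounded arrays of natural numbers; a scalar variable is the cell with index 0 of its array. A
  program mentions only finitely many names. Multiplication and division are deliberately not
  primitive: with addition and (truncated) subtraction only, the unit-cost measure is the usual one.
  The output is a write-only tape.
\<close>

datatype aexp =
    Const nat
  | Cell string aexp
  | Add aexp aexp
  | Sub aexp aexp

datatype bexp =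
    Less aexp aexp
  | BNot bexp
  | BAnd bexp bexp

datatype com =
    Skip
  | Store string aexp aexp
  | Output aexp
  | Seq com com
  | Cond bexp com com
  | While bexp com

type_synonym memory = "string \<Rightarrow> nat \<Rightarrow> nat"

type_synonym config = "memory \<times> nat list"

primrec aval :: "aexp \<Rightarrow> memory \<Rightarrow> nat" where
  "aval (Const c) M = c"
| "aval (Cell x a) M = M x (aval a M)"
| "aval (Add a b) M = aval a M + aval b M"
| "aval (Sub a b) M = aval a M - aval b M"

primrec bval :: "bexp \<Rightarrow> memory \<Rightarrow> bool" where
  "bval (Less a b) M \<longleftrightarrow> aval a M < aval b M"
| "bval (BNot b) M \<longleftrightarrow> \<not> bval b M"
| "bval (BAnd b c) M \<longleftrightarrow> bval b M \<and> bval c M"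

text \<open>
  \<open>exec P \<sigma> T \<sigma>'\<close>: started in \<open>\<sigma>\<close>, the program \<open>P\<close> halts in \<open>\<sigma>'\<close> after \<open>T\<close> steps. The expressions
  of a program have a fixed number of operators, so charging a single step for the evaluation of an
  expression changes the time only by a constant factor depending on the program.
\<close>

inductive exec :: "com \<Rightarrow> config \<Rightarrow> nat \<Rightarrow> config \<Rightarrow> bool" where
  Skip: "exec Skip \<sigma> 1 \<sigma>"
| Store: "exec (Store x i a) (M, out) 1 (M(x := (M x)(aval i M := aval a M)), out)"
| Output: "exec (Output a) (M, out) 1 (M, out @ [aval a M])"
| Seq: "exec c\<^sub>1 \<sigma> T\<^sub>1 \<sigma>' \<Longrightarrow> exec c\<^sub>2 \<sigma>' T\<^sub>2 \<sigma>'' \<Longrightarrow> exec (Seq c\<^sub>1 c\<^sub>2) \<sigma> (T\<^sub>1 + T\<^sub>2) \<sigma>''"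
| CondTrue: "bval b (fst \<sigma>) \<Longrightarrow> exec c\<^sub>1 \<sigma> T \<sigma>' \<Longrightarrow> exec (Cond b c\<^sub>1 c\<^sub>2) \<sigma> (T + 1) \<sigma>'"
| CondFalse: "\<not> bval b (fst \<sigma>) \<Longrightarrow> exec c\<^sub>2 \<sigma> T \<sigma>' \<Longrightarrow> exec (Cond b c\<^sub>1 c\<^sub>2) \<sigma> (T + 1) \<sigma>'"
| WhileFalse: "\<not> bval b (fst \<sigma>) \<Longrightarrow> exec (While b c) \<sigma> 1 \<sigma>"
| WhileTrue: "bval b (fst \<sigma>) \<Longrightarrow> exec c \<sigma> T\<^sub>1 \<sigma>' \<Longrightarrow> exec (While b c) \<sigma>' T\<^sub>2 \<sigma>'' \<Longrightarrow>
    exec (While b c) \<sigma> (T\<^sub>1 + T\<^sub>2 + 1) \<sigma>''"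

section \<open>Input and output format\<close>

text \<open>
  A graph is presented with vertices \<open>0, \<dots>, n - 1\<close> and edges \<open>0, \<dots>, m - 1\<close>, in no particular
  order, as the arrays of the tails and the heads of its edges.
\<close>

definition numbered :: "(nat, nat) pre_digraph \<Rightarrow> bool" where
  "numbered G \<longleftrightarrow> verts G = {..<card (verts G)} \<and> arcs G = {..<card (arcs G)}"

definition scalar :: "nat \<Rightarrow> nat \<Rightarrow> nat" where
  "scalar a = (\<lambda>_. 0)(0 := a)"

definition edge_array :: "(nat, nat) pre_digraph \<Rightarrow> (nat \<Rightarrow> nat) \<Rightarrow> nat \<Rightarrow> nat" where
  "edge_array G h = (\<lambda>e. if e \<in> arcs G then h e else 0)"

definition input_memory :: "(nat, nat) pre_digraph \<Rightarrow> nat \<Rightarrow> nat \<Rightarrow> (nat \<Rightarrow> nat) \<Rightarrow> memory" where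
  "input_memory G s t f = (\<lambda>_ _. 0)
     (''n'' := scalar (card (verts G)),
      ''m'' := scalar (card (arcs G)),
      ''s'' := scalar s,
      ''t'' := scalar t,
      ''tail'' := edge_array G (tail G),
      ''head'' := edge_array G (head G),
      ''flow'' := edge_array G f)"

definition encode_decomposition :: "(nat \<times> nat list) list \<Rightarrow> nat list" where
  "encode_decomposition D = concat (map (\<lambda>(w, p). w # length p # p) D)"

end

theory Submission
  imports Defs
begin

text \<open>
  For \<open>q = 2\<^sup>L, \<dots>, 2, 1\<close>, where \<open>2\<^sup>L\<close> is the largest power of two that is at most the norm of the
  flow, subtract \<open>q\<close> along \<open>s\<close>-\<open>t\<close> paths whose edges all have remaining flow at least \<open>q\<close>, until none is
  left. At the beginning of a phase with remaining flow \<open>F\<close> no path has all its edges of flow at least \<open>2q\<close>.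
  Let \<open>S\<close> be the set of vertices reachable from \<open>s\<close> by edges of flow at least \<open>2q\<close>. Each path found in
  the phase leaves \<open>S\<close> for a last time by an edge of flow less than \<open>2q\<close>, so these edges are distinct.
  Replacing the part of each path before its last exit by a walk inside \<open>S\<close> gives a flow supported in
  the support of \<open>f\<close>, hence below a multiple of \<open>f\<close>, none of whose edges enters \<open>S\<close>. The last exits are
  thus an antichain of its support, and by width-stability their number is at most the width of the
  support of \<open>f\<close>, which is at most the size of any decomposition of \<open>f\<close>.

  The paths of a phase are found by a depth-first search in which every vertex keeps a pointer into
  the list of all edges. The pointers only advance, which costs at most \<open>n m\<close> steps per phase, and
  each of the at most \<open>m\<close> paths costs \<open>O(n)\<close> further steps.
\<close>

section \<open>Walks and flows\<close>

locale st_network =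
  fixes G :: "('v, 'e) pre_digraph" and s t :: 'v
  assumes st_dag: "st_dag G s t"

sublocale st_network \<subseteq> fin_digraph G
  using st_dag by (simp add: st_dag_def)

context st_network
begin

lemma no_closed_walk: "\<not> closed_w p"
  using closed_w_imp_cycle st_dag unfolding st_dag_def by blast

text \<open>A repeated vertex would cut a closed walk out of the walk. The proofs below therefore
  work with walks, which can be cut and spliced without rechecking that vertices are
  distinct.\<close>

lemma awalk_imp_apath: "awalk u p v \<Longrightarrow> apath u p v"
  unfolding apath_def by (auto elim: awalk_cyc_decompE' simp: no_closed_walk)

lemma apath_iff_awalk: "apath u p v \<longleftrightarrow> awalk u p v"
  using awalk_imp_apath awalkI_apath by blast

lemma source_in_verts: "s \<in> verts G" and sink_in_verts: "t \<in> verts G"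
  using st_dag unfolding st_dag_def by blast+

lemma head_neq_source: "e \<in> arcs G \<Longrightarrow> head G e \<noteq> s"
proof
  assume e: "e \<in> arcs G" "head G e = s"
  have "in_degree G s = 0" using st_dag unfolding st_dag_def by blast
  then have "in_arcs G s = {}" using finite_in_arcs[of s] by (simp add: in_degree_def)
  with e show False by (auto simp: in_arcs_def)
qed

lemma tail_neq_sink: "e \<in> arcs G \<Longrightarrow> tail G e \<noteq> t"
proof
  assume e: "e \<in> arcs G" "tail G e = t"
  have "out_degree G t = 0" using st_dag unfolding st_dag_def by blast
  then have "out_arcs G t = {}" using finite_out_arcs[of t] by (simp add: out_degree_def)
  with e show False by (auto simp: out_arcs_def)
qed

text \<open>The arc lies on some path from \<open>s\<close> to \<open>t\<close>, which would be a
  closed walk if \<open>s = t\<close>. A single vertex without arcs is both source and sink, hence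
  the hypothesis.\<close>

lemma source_neq_sink: "e \<in> arcs G \<Longrightarrow> s \<noteq> t"
proof
  assume e: "e \<in> arcs G" "s = t"
  from e st_dag obtain p where p: "apath s p t" "e \<in> set p" unfolding st_dag_def by blast
  then have "closed_w p" using e by (auto simp: closed_w_def apath_iff_awalk)
  then show False using no_closed_walk by blast
qed

lemma awalk_tails_distinct: "awalk u p v \<Longrightarrow> distinct (map (tail G) p)"
  using awalk_imp_apath[of u p v] by (auto simp: apath_def awalk_verts_conv split: if_splits)

lemma awalk_distinct: "awalk u p v \<Longrightarrow> distinct p"
  using awalk_tails_distinct by (blast intro: distinct_map[THEN iffD1, THEN conjunct1])

lemma awalk_end_not_tail: "awalk u p v \<Longrightarrow> v \<notin> tail G ` set p"
proof
  assume w: "awalk u p v" and "v \<in> tail G ` set p"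
  then obtain e where e: "e \<in> set p" "tail G e = v" by blast
  then obtain xs ys where "p = xs @ e # ys" by (meson split_list)
  then have "awalk v (e # ys) v" using w e by (auto simp: awalk_Cons_iff)
  then have "closed_w (e # ys)" by (auto simp: closed_w_def)
  then show False using no_closed_walk by blast
qed

lemma awalk_length_less: "awalk u p v \<Longrightarrow> length p < card (verts G)"
  using awalk_imp_apath length_apath_less by blast

text \<open>Counting occurrences instead of testing membership lets the induction prepend an arc
  without asking whether it recurs later. The \<open>of_bool\<close> terms make up for the missing
  arrival at the start and the missing departure at the end.\<close>

lemma awalk_count_conservation:
  assumes "awalk u p w"
  shows "(\<Sum>e\<in>in_arcs G v. count_list p e) + of_bool (v = u) =
         (\<Sum>e\<in>out_arcs G v. count_list p e) + of_bool (v = w)"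
  using assms
proof (induction p arbitrary: u)
  case Nil
  then show ?case by (auto simp: awalk_Nil_iff)
next
  case (Cons a p)
  then have a: "a \<in> arcs G" "tail G a = u" "awalk (head G a) p w"
    by (auto simp: awalk_Cons_iff)
  have split: "(\<Sum>e\<in>X. count_list (a # p) e) = (\<Sum>e\<in>X. count_list p e) + of_bool (a \<in> X)"
    if "finite X" for X
  proof -
    have "(\<Sum>e\<in>X. count_list (a # p) e) = (\<Sum>e\<in>X. count_list p e + (if e = a then 1 else 0))"
      by (rule sum.cong) auto
    also have "\<dots> = (\<Sum>e\<in>X. count_list p e) + of_bool (a \<in> X)"
      using that by (simp add: sum.distrib)
    finally show ?thesis .
  qed
  have "a \<in> in_arcs G v \<longleftrightarrow> v = head G a" "a \<in> out_arcs G v \<longleftrightarrow> v = u"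
    using a by (auto simp: in_arcs_def out_arcs_def)
  then show ?case using Cons.IH[OF a(3)] by (simp only: split finite_in_arcs finite_out_arcs)
qed

lemma awalk_is_flow:
  assumes "awalk s p t"
  shows "is_flow G s t (\<lambda>e. of_bool (e \<in> set p))"
  unfolding is_flow_def
proof
  fix v assume v: "v \<in> verts G - {s, t}"
  have count: "count_list q e = of_bool (e \<in> set q)" if "distinct q" for q e
    using that by (induction q) auto
  have "count_list p e = of_bool (e \<in> set p)" for e
    by (rule count[OF awalk_distinct[OF assms]])
  then show "(\<Sum>e\<in>in_arcs G v. of_bool (e \<in> set p) :: nat) = (\<Sum>e\<in>out_arcs G v. of_bool (e \<in> set p))"
    using awalk_count_conservation[OF assms, of v] v by simp
qed

end

section \<open>Sums of flows and of paths\<close>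

lemma is_flow_add: "is_flow G s t f \<Longrightarrow> is_flow G s t g \<Longrightarrow> is_flow G s t (\<lambda>e. f e + g e)"
  by (simp add: is_flow_def sum.distrib)

lemma is_flow_scale: "is_flow G s t f \<Longrightarrow> is_flow G s t (\<lambda>e. c * f e)"
  by (simp add: is_flow_def flip: sum_distrib_left)

text \<open>This gives conservation for what remains of a flow after paths are removed, while
  avoiding truncated subtraction.\<close>

lemma is_flow_cancel:
  "is_flow G s t (\<lambda>e. f e + g e) \<Longrightarrow> is_flow G s t g \<Longrightarrow> is_flow G s t f"
  by (simp add: is_flow_def sum.distrib)

lemma is_flow_cong:
  assumes "\<And>e. e \<in> arcs G \<Longrightarrow> f e = g e"
  shows "is_flow G s t f \<longleftrightarrow> is_flow G s t g"
proof -
  have "(\<Sum>e\<in>in_arcs G v. f e) = (\<Sum>e\<in>in_arcs G v. g e)"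
    "(\<Sum>e\<in>out_arcs G v. f e) = (\<Sum>e\<in>out_arcs G v. g e)" for v
    using assms by (auto intro!: sum.cong simp: in_arcs_def out_arcs_def)
  then show ?thesis by (simp add: is_flow_def)
qed

text \<open>The sum in \<open>flow_decomposition\<close>, named so that it can be treated as a flow
  itself.\<close>

definition path_sum :: "(nat \<times> 'e list) list \<Rightarrow> 'e \<Rightarrow> nat" where
  "path_sum D e = (\<Sum>(w, p) \<leftarrow> D. w * of_bool (e \<in> set p))"

lemma path_sum_simps [simp]:
  "path_sum [] e = 0"
  "path_sum ((w, p) # D) e = w * of_bool (e \<in> set p) + path_sum D e"
  "path_sum (D @ D') e = path_sum D e + path_sum D' e"
  by (auto simp: path_sum_def)

lemma path_sum_pos_iff: "path_sum D e > 0 \<longleftrightarrow> (\<exists>(w, p) \<in> set D. w > 0 \<and> e \<in> set p)"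
  by (induction D) auto

context st_network
begin

lemma path_sum_is_flow:
  "\<forall>(w, p) \<in> set D. awalk s p t \<Longrightarrow> is_flow G s t (path_sum D)"
proof (induction D)
  case Nil
  then show ?case by (simp add: is_flow_def)
next
  case (Cons a D)
  obtain w p where a: "a = (w, p)" by force
  have "is_flow G s t (\<lambda>e. w * of_bool (e \<in> set p) + path_sum D e)"
    using Cons a by (intro is_flow_add is_flow_scale awalk_is_flow) auto
  then show ?case by (simp add: a path_sum_simps(2)[abs_def])
qed

text \<open>Acyclicity bounds lengths, so there is a longest walk of positive arcs through
  \<open>e\<close>. Conservation would prolong it at a start other than \<open>s\<close> or an end
  other than \<open>t\<close>.\<close>

lemma positive_flow_path:
  assumes flow: "is_flow G s t g" and e: "e \<in> arcs G" "g e > 0"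
  obtains p where "awalk s p t" "p \<noteq> []" "\<forall>a\<in>set p. g a > 0"
proof -
  define P where "P p \<longleftrightarrow> e \<in> set p \<and> (\<exists>u v. awalk u p v) \<and> (\<forall>a\<in>set p. g a > 0)" for p
  have "P [e]" using e arc_implies_awalk[of e] by (auto simp: P_def)
  moreover have "\<forall>p. P p \<longrightarrow> length p < card (verts G)"
    using awalk_length_less by (auto simp: P_def)
  ultimately obtain p where p: "P p" and max: "\<And>q. P q \<Longrightarrow> length q \<le> length p"
    using ex_has_greatest_nat[of P "[e]" length "card (verts G)"] by blast
  then obtain u v where w: "awalk u p v" and ep: "e \<in> set p" and pos: "\<forall>a\<in>set p. g a > 0"
    by (auto simp: P_def)
  have ne: "p \<noteq> []" using ep by auto
  have sets: "set p \<subseteq> arcs G" using w by blast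
  have cons: "(\<Sum>a\<in>in_arcs G x. g a) = (\<Sum>a\<in>out_arcs G x. g a)"
    if "x \<in> verts G" "x \<noteq> s" "x \<noteq> t" for x
    using flow that by (simp add: is_flow_def)
  have "u = s"
  proof (rule ccontr)
    assume "u \<noteq> s"
    obtain a q where q: "p = a # q" using ne by (cases p) auto
    then have a: "a \<in> arcs G" "tail G a = u" using w by (auto simp: awalk_Cons_iff)
    then have "a \<in> out_arcs G u" by (simp add: out_arcs_def)
    moreover have "g a > 0" using pos q by simp
    ultimately have "(\<Sum>a\<in>out_arcs G u. g a) > 0"
      using finite_out_arcs by (metis gr0I sum_eq_0_iff)
    \<comment> \<open>As the tail of an arc, \<open>u\<close> is not \<open>t\<close> either, so
      conservation applies to it.\<close>
    then have "(\<Sum>a\<in>in_arcs G u. g a) > 0"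
      using cons[of u] \<open>u \<noteq> s\<close> tail_neq_sink a w by auto
    then obtain b where b: "b \<in> in_arcs G u" "g b > 0"
      by (metis gr0I not_less_zero sum.neutral)
    then have "awalk (tail G b) (b # p) v"
      using w by (auto simp: awalk_Cons_iff in_arcs_def)
    then have "P (b # p)" using b ep pos by (auto simp: P_def)
    then show False using max by force
  qed
  moreover have "v = t"
  proof (rule ccontr)
    assume "v \<noteq> t"
    obtain a q where q: "p = q @ [a]" using ne by (cases p rule: rev_cases) auto
    then have a: "a \<in> arcs G" "head G a = v" using w by (auto simp: awalk_Cons_iff awalk_Nil_iff)
    then have "a \<in> in_arcs G v" by (simp add: in_arcs_def)
    moreover have "g a > 0" using pos q by simp
    ultimately have "(\<Sum>a\<in>in_arcs G v. g a) > 0"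
      using finite_in_arcs by (metis gr0I sum_eq_0_iff)
    then have "(\<Sum>a\<in>out_arcs G v. g a) > 0"
      using cons[of v] \<open>v \<noteq> t\<close> head_neq_source a w by auto
    then obtain b where b: "b \<in> out_arcs G v" "g b > 0"
      by (metis gr0I not_less_zero sum.neutral)
    then have "awalk u (p @ [b]) (head G b)"
      using w by (auto simp: awalk_Cons_iff awalk_Nil_iff out_arcs_def)
    then have "P (p @ [b])" using b ep pos by (auto simp: P_def)
    then show False using max by force
  qed
  ultimately show thesis using that w ne pos by blast
qed

section \<open>Flow-subgraphs and their width\<close>

text \<open>The flow-subgraph keeps only vertices that carry flow. The first arc of \<open>p\<close>
  shows that \<open>s\<close> is one of them, which is why the empty walk is excluded.\<close>

lemma awalk_flow_subgraph:
  assumes "awalk s p t" "p \<noteq> []" "\<forall>e\<in>set p. h e > 0"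
  shows "pre_digraph.apath (flow_subgraph G h) s p t"
proof -
  let ?H = "flow_subgraph G h"
  have "compatible G ?H" by (simp add: compatible_def flow_subgraph_def)
  note eqs = compatible_cas[OF this] compatible_awalk_verts[OF this]
  obtain a q where p: "p = a # q" using assms(2) by (cases p) auto
  then have a: "a \<in> out_arcs G s" using assms(1) by (auto simp: awalk_Cons_iff out_arcs_def)
  moreover have "h a > 0" using assms p by simp
  ultimately have "(\<Sum>e\<in>out_arcs G s. h e) > 0"
    using finite_out_arcs by (metis gr0I sum_eq_0_iff)
  then have "s \<in> verts ?H" using source_in_verts by (simp add: flow_subgraph_def)
  moreover have "set p \<subseteq> arcs ?H" using assms by (auto simp: flow_subgraph_def)
  ultimately show ?thesis
    using awalk_imp_apath[OF assms(1)]
    by (auto simp: pre_digraph.apath_def pre_digraph.awalk_def eqs)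
qed

lemma flow_subgraph_awalk:
  assumes "pre_digraph.apath (flow_subgraph G h) s p t"
  shows "cas s p t" "set p \<subseteq> arcs G" "\<forall>e\<in>set p. h e > 0"
proof -
  let ?H = "flow_subgraph G h"
  have "compatible G ?H" by (simp add: compatible_def flow_subgraph_def)
  note eqs = compatible_cas[OF this]
  show "cas s p t" "set p \<subseteq> arcs G" "\<forall>e\<in>set p. h e > 0"
    using assms by (auto simp: pre_digraph.apath_def pre_digraph.awalk_def eqs flow_subgraph_def)
qed

lemma flow_decomposition_iff:
  "flow_decomposition G s t f D \<longleftrightarrow>
     (\<forall>(w, p) \<in> set D. awalk s p t) \<and> (\<forall>e\<in>arcs G. f e = path_sum D e)"
  by (simp add: flow_decomposition_def path_sum_def apath_iff_awalk)

text \<open>The paths of positive weight in a smallest decomposition cover the support of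
  \<open>f\<close>. The hypothesis ensures that the \<open>LEAST\<close> in \<open>mfd\<close> is
  attained; later the output of the algorithm itself discharges it.\<close>

lemma width_le_mfd:
  assumes "\<exists>D. flow_decomposition G s t f D"
  shows "width (flow_subgraph G f) s t \<le> mfd G s t f"
proof -
  let ?H = "flow_subgraph G f"
  have "\<exists>D. flow_decomposition G s t f D \<and> length D = mfd G s t f"
    unfolding mfd_def by (rule LeastI_ex) (use assms in blast)
  then obtain D where D: "flow_decomposition G s t f D" and len: "length D = mfd G s t f" by blast
  \<comment> \<open>Paths of weight 0 may leave the support, and an empty path need not be a path of
    the flow-subgraph.\<close>
  define ps where "ps = map snd (filter (\<lambda>(w, p). w > 0 \<and> p \<noteq> []) D)"
  have fe: "f e = path_sum D e" if "e \<in> arcs G" for e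
    using D that by (simp add: flow_decomposition_iff)
  have "\<forall>p\<in>set ps. pre_digraph.apath ?H s p t"
  proof
    fix p assume "p \<in> set ps"
    then obtain w where w: "(w, p) \<in> set D" "w > 0" "p \<noteq> []" by (auto simp: ps_def)
    then have aw: "awalk s p t" using D by (auto simp: flow_decomposition_iff)
    have "f e > 0" if "e \<in> set p" for e
    proof -
      have "e \<in> arcs G" using aw that by blast
      then show ?thesis using fe w that by (auto simp: path_sum_pos_iff)
    qed
    then show "pre_digraph.apath ?H s p t" using awalk_flow_subgraph aw w by blast
  qed
  moreover have "arcs ?H \<subseteq> (\<Union>p\<in>set ps. set p)"
  proof
    fix e assume "e \<in> arcs ?H"
    then have "path_sum D e > 0" using fe by (auto simp: flow_subgraph_def)
    then show "e \<in> (\<Union>p\<in>set ps. set p)"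
      unfolding path_sum_pos_iff ps_def by fastforce
  qed
  ultimately have "width ?H s t \<le> length ps"
    unfolding width_def by (intro Least_le) blast
  also have "\<dots> \<le> length D" by (simp add: ps_def)
  finally show ?thesis using len by simp
qed

section \<open>Exits from a vertex set and the bound on the number of paths\<close>

lemma awalk_last_exit:
  assumes "awalk u p v" "u \<in> S" "v \<notin> S"
  obtains p1 e p2 where "p = p1 @ e # p2" "tail G e \<in> S" "head G e \<notin> S"
    "\<forall>a\<in>set p2. head G a \<notin> S"
  using assms
proof (induction p arbitrary: v thesis rule: rev_induct)
  case Nil
  then show ?case by (auto simp: awalk_Nil_iff)
next
  case (snoc a p)
  then have a: "awalk u p (tail G a)" "head G a = v" by (auto simp: awalk_Cons_iff awalk_Nil_iff)
  show ?case
  proof (cases "tail G a \<in> S")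
    case True
    then show ?thesis using snoc.prems(1)[of p a "[]"] a snoc.prems by auto
  next
    case False
    obtain p1 e p2 where "p = p1 @ e # p2" "tail G e \<in> S" "head G e \<notin> S"
      "\<forall>a\<in>set p2. head G a \<notin> S"
      using snoc.IH[OF _ a(1) snoc.prems(3) False] by blast
    then show ?thesis using snoc.prems(1)[of p1 e "p2 @ [a]"] a snoc.prems by auto
  qed
qed

text \<open>A walk without arcs that enter \<open>S\<close> from outside cannot return after leaving
  \<open>S\<close>. In a cover by such walks each one covers at most one exit, so the exits bound
  the width from below.\<close>

lemma cas_exit_unique:
  assumes "cas u p v" "\<forall>a\<in>set p. head G a \<in> S \<longrightarrow> tail G a \<in> S"
  shows "card {a \<in> set p. tail G a \<in> S \<and> head G a \<notin> S} \<le> 1"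
proof -
  have outside: "tail G a \<notin> S"
    if "cas u p v" "\<forall>a\<in>set p. head G a \<in> S \<longrightarrow> tail G a \<in> S" "u \<notin> S" "a \<in> set p" for u a p
    using that by (induction p arbitrary: u) auto
  show ?thesis using assms
  proof (induction p arbitrary: u)
    case (Cons b p)
    let ?X = "\<lambda>p. {a \<in> set p. tail G a \<in> S \<and> head G a \<notin> S}"
    show ?case
    proof (cases "tail G b \<in> S \<and> head G b \<notin> S")
      case True
      then have "?X (b # p) \<subseteq> {b}" using outside[of "head G b" p] Cons.prems by auto
      then show ?thesis using card_mono[of "{b}"] by fastforce
    next
      case False
      then have "?X (b # p) = ?X p" by auto
      then show ?thesis using Cons.IH[of "head G b"] Cons.prems by simp
    qed
  qed simp
qed

text \<open>The empty walk, present when \<open>s = t\<close>, has no light arc. Excluding it makes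
  the notion hold trivially for a graph without arcs.\<close>

definition blocked :: "('e \<Rightarrow> nat) \<Rightarrow> nat \<Rightarrow> bool" where
  "blocked g q \<longleftrightarrow> (\<forall>p. awalk s p t \<and> p \<noteq> [] \<longrightarrow> (\<exists>e\<in>set p. g e < q))"

text \<open>\<open>E\<close> are the last exits from \<open>S\<close>, and \<open>Q\<close> the rerouted paths.\<close>

lemma uncrossed_antichain:
  assumes "blocked F (2 * q)" "s \<noteq> t" "q > 0"
    and Ps: "\<forall>p\<in>set Ps. awalk s p t"
    and le: "\<And>e. e \<in> arcs G \<Longrightarrow> q * length (filter (\<lambda>p. e \<in> set p) Ps) \<le> F e"
  obtains S E Q where "E \<subseteq> arcs G" "card E = length Ps" "length Q = length Ps"
    "E \<subseteq> (\<Union>p\<in>set Q. set p)" "\<forall>p\<in>set Q. awalk s p t"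
    "\<forall>e\<in>E. tail G e \<in> S \<and> head G e \<notin> S"
    "\<forall>p\<in>set Q. \<forall>e\<in>set p. F e > 0 \<and> (head G e \<in> S \<longrightarrow> tail G e \<in> S)"
proof -
  define S where "S = {v. \<exists>p. awalk s p v \<and> (\<forall>e\<in>set p. 2 * q \<le> F e)}"
  have sS: "s \<in> S" using source_in_verts by (auto simp: S_def awalk_Nil_iff intro!: exI[of _ "[]"])
  have tS: "t \<notin> S"
  proof
    assume "t \<in> S"
    then obtain p where p: "awalk s p t" "\<forall>e\<in>set p. 2 * q \<le> F e" by (auto simp: S_def)
    then have "p \<noteq> []" using assms(2) by (auto simp: awalk_Nil_iff)
    then show False using p assms(1) by (force simp: blocked_def)
  qed
  have S_step: "head G e \<in> S" if e: "e \<in> arcs G" "tail G e \<in> S" "2 * q \<le> F e" for e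
  proof -
    obtain p where "awalk s p (tail G e)" "\<forall>e\<in>set p. 2 * q \<le> F e"
      using e(2) unfolding S_def by blast
    then have "awalk s (p @ [e]) (head G e)" "\<forall>e\<in>set (p @ [e]). 2 * q \<le> F e"
      using e by (auto simp: awalk_Cons_iff awalk_Nil_iff)
    then show ?thesis unfolding S_def by blast
  qed
  have S_tails: "tail G e \<in> S" if p: "awalk s p v" "\<forall>e\<in>set p. 2 * q \<le> F e" "e \<in> set p" for p v e
  proof -
    obtain xs ys where "p = xs @ e # ys" using p(3) by (meson split_list)
    then have "awalk s xs (tail G e)" "\<forall>e\<in>set xs. 2 * q \<le> F e"
      using p by (auto simp: awalk_Cons_iff)
    then show ?thesis by (auto simp: S_def)
  qed
  have "\<exists>e r. e \<in> set p \<and> tail G e \<in> S \<and> head G e \<notin> S \<and> awalk s r t \<and> e \<in> set r \<and>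
      (\<forall>a\<in>set r. F a > 0 \<and> (head G a \<in> S \<longrightarrow> tail G a \<in> S))" if p: "p \<in> set Ps" for p
  proof -
    have aw: "awalk s p t" using p Ps by blast
    from awalk_last_exit[OF aw sS tS] obtain p1 e p2
      where e: "p = p1 @ e # p2" "tail G e \<in> S" "head G e \<notin> S" "\<forall>a\<in>set p2. head G a \<notin> S"
      by blast
    then obtain r where r: "awalk s r (tail G e)" "\<forall>a\<in>set r. 2 * q \<le> F a" by (auto simp: S_def)
    \<comment> \<open>In the rerouted walk all tails of \<open>r\<close> are in \<open>S\<close>,
      the arc \<open>e\<close> leaves \<open>S\<close>, and no head in \<open>p2\<close> is in
      \<open>S\<close>. So none of its arcs enters \<open>S\<close> from outside.\<close>
    have "awalk s (r @ e # p2) t" using aw e(1) r(1) by (auto simp: awalk_Cons_iff)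
    moreover have "F a > 0" if "a \<in> set p" for a
    proof -
      have "a \<in> arcs G" using aw that by blast
      moreover have "filter (\<lambda>p. a \<in> set p) Ps \<noteq> []" using p that by (auto simp: filter_empty_conv)
      ultimately show ?thesis using le[of a] \<open>q > 0\<close>
        by (metis gr0I le_zero_eq length_0_conv mult_is_0 not_less_zero)
    qed
    moreover have "F a > 0 \<and> (head G a \<in> S \<longrightarrow> tail G a \<in> S)" if "a \<in> set r" for a
      using S_tails[OF r that] bspec[OF r(2) that] \<open>q > 0\<close> by auto
    ultimately show ?thesis
      using e by (intro exI[of _ e] exI[of _ "r @ e # p2"]) auto
  qed
  then obtain ex rt where ex: "\<And>p. p \<in> set Ps \<Longrightarrow> ex p \<in> set p \<and> tail G (ex p) \<in> S \<and>
      head G (ex p) \<notin> S \<and> awalk s (rt p) t \<and> ex p \<in> set (rt p) \<and>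
      (\<forall>a\<in>set (rt p). F a > 0 \<and> (head G a \<in> S \<longrightarrow> tail G a \<in> S))"
    by metis
  have ex_arc: "ex p \<in> arcs G" if "p \<in> set Ps" for p
    using ex[OF that] Ps that by blast
  \<comment> \<open>Two paths with the same last exit would force flow at least \<open>2 * q\<close>
    on it, and \<open>S_step\<close> would then put its head into \<open>S\<close>. Positions are
    compared because a path may occur repeatedly in \<open>Ps\<close>.\<close>
  have "distinct (map ex Ps)"
  proof (rule ccontr)
    assume "\<not> distinct (map ex Ps)"
    then obtain i j where ij: "i < j" "j < length Ps" "ex (Ps ! i) = ex (Ps ! j)"
      by (auto simp: distinct_conv_nth) (metis linorder_neqE_nat)
    let ?e = "ex (Ps ! i)"
    have mem: "Ps ! i \<in> set Ps" "Ps ! j \<in> set Ps" using ij by auto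
    have "{i, j} \<subseteq> {k. k < length Ps \<and> ?e \<in> set (Ps ! k)}"
      using ij ex[OF mem(1)] ex[OF mem(2)] by auto
    then have "card {i, j} \<le> card {k. k < length Ps \<and> ?e \<in> set (Ps ! k)}"
      by (intro card_mono) auto
    then have "2 \<le> length (filter (\<lambda>p. ?e \<in> set p) Ps)"
      using ij by (simp add: length_filter_conv_card)
    then have "2 * q \<le> F ?e"
      using le[OF ex_arc[OF mem(1)]] by (metis le_trans mult.commute mult_le_mono2)
    then show False using S_step[OF ex_arc[OF mem(1)]] ex[OF mem(1)] by blast
  qed
  then have "card (ex ` set Ps) = length Ps"
    using distinct_card[of "map ex Ps"] by simp
  then show thesis
    using that[of "ex ` set Ps" "map rt Ps" S] ex ex_arc by fastforce
qed

text \<open>The hypothesis \<open>le\<close> says that the paths, each with weight \<open>q\<close>,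
  fit into \<open>F\<close> together. The first bound limits the size of the decomposition; the
  second limits how often the search can emit a path.\<close>

lemma paths_le_width:
  assumes ws: "width_stable G s t" and f: "is_flow G s t f"
    and "blocked F (2 * q)" "s \<noteq> t" "q > 0"
    and Ff: "\<And>e. e \<in> arcs G \<Longrightarrow> F e \<le> f e"
    and Ps: "\<forall>p\<in>set Ps. awalk s p t"
    and le: "\<And>e. e \<in> arcs G \<Longrightarrow> q * length (filter (\<lambda>p. e \<in> set p) Ps) \<le> F e"
  shows "length Ps \<le> width (flow_subgraph G f) s t" "length Ps \<le> card (arcs G)"
proof -
  obtain S E Q where E: "E \<subseteq> arcs G" "card E = length Ps" and lenQ: "length Q = length Ps"
    and EQ: "E \<subseteq> (\<Union>p\<in>set Q. set p)" and Q: "\<forall>p\<in>set Q. awalk s p t"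
    and ES: "\<forall>e\<in>E. tail G e \<in> S \<and> head G e \<notin> S"
    and QS: "\<forall>p\<in>set Q. \<forall>e\<in>set p. F e > 0 \<and> (head G e \<in> S \<longrightarrow> tail G e \<in> S)"
    by (rule uncrossed_antichain[OF assms(3-5) Ps le])
  show "length Ps \<le> card (arcs G)" using E card_mono finite_arcs by metis
  \<comment> \<open>No value of \<open>h\<close> exceeds \<open>length Ps\<close>, so
    \<open>k * f\<close> dominates \<open>h\<close> on the support of \<open>f\<close>. The added 1
    keeps \<open>k\<close> positive, so that scaling preserves the support even if \<open>Ps\<close>
    is empty.\<close>
  define k where "k = length Ps + 1"
  define h where "h = path_sum (map (Pair 1) Q)"
  let ?H = "flow_subgraph G h"
  have h_pos: "h e > 0 \<longleftrightarrow> (\<exists>p\<in>set Q. e \<in> set p)" for e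
    by (auto simp: h_def path_sum_pos_iff)
  have h_flow: "is_flow G s t h"
    unfolding h_def using Q by (intro path_sum_is_flow) auto
  have "path_sum (map (Pair 1) ps) e \<le> length ps" for ps :: "'e list list" and e
    by (induction ps) auto
  then have h_le: "h e \<le> length Ps" for e using lenQ unfolding h_def by metis
  have "h e \<le> k * f e" if "e \<in> arcs G" for e
  proof (cases "h e = 0")
    case False
    then have "F e > 0" using h_pos QS by blast
    then have "f e \<ge> 1" using Ff[OF that] by simp
    then have "k * 1 \<le> k * f e" by (intro mult_le_mono2)
    then show ?thesis using h_le[of e] k_def by simp
  qed simp
  then have "width ?H s t \<le> width (flow_subgraph G (\<lambda>e. k * f e)) s t"
    using ws h_flow is_flow_scale[OF f, of k] unfolding width_stable_def by blast
  also have "flow_subgraph G (\<lambda>e. k * f e) = flow_subgraph G f"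
    by (auto simp: flow_subgraph_def k_def simp flip: sum_distrib_left simp del: mult_Suc)
  finally have "width ?H s t \<le> width (flow_subgraph G f) s t" .
  moreover have "length Ps \<le> width ?H s t"
  proof -
    have "Q = [] \<or> [] \<notin> set Q" using Q \<open>s \<noteq> t\<close> by (auto simp: awalk_Nil_iff)
    then have "\<forall>p\<in>set Q. pre_digraph.apath ?H s p t"
      using Q h_pos by (intro ballI awalk_flow_subgraph) auto
    moreover have "arcs ?H \<subseteq> (\<Union>p\<in>set Q. set p)" using h_pos by (auto simp: flow_subgraph_def)
    \<comment> \<open>\<open>Q\<close> itself covers the flow-subgraph of \<open>h\<close>, so the
      \<open>LEAST\<close> in \<open>width\<close> is attained by some cover.\<close>
    ultimately have "\<exists>k ps. (\<forall>p \<in> set ps. pre_digraph.apath ?H s p t) \<and>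
                    arcs ?H \<subseteq> (\<Union>p \<in> set ps. set p) \<and> length ps = k" by blast
    from LeastI_ex[OF this] obtain ps where ps: "\<forall>p \<in> set ps. pre_digraph.apath ?H s p t"
      "arcs ?H \<subseteq> (\<Union>p \<in> set ps. set p)" "length ps = width ?H s t"
      unfolding width_def by blast
    let ?X = "\<lambda>p. {a \<in> set p. tail G a \<in> S \<and> head G a \<notin> S}"
    have "E \<subseteq> arcs ?H" using E(1) EQ h_pos by (auto simp: flow_subgraph_def)
    then have "E \<subseteq> (\<Union>p\<in>set ps. ?X p)" using ps(2) ES by blast
    then have "card E \<le> card (\<Union>p\<in>set ps. ?X p)" by (intro card_mono) auto
    also have "\<dots> \<le> (\<Sum>p\<in>set ps. card (?X p))" by (intro card_UN_le) auto
    also have "\<dots> \<le> (\<Sum>p\<in>set ps. 1)"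
    proof (rule sum_mono)
      fix p assume "p \<in> set ps"
      then have p: "cas s p t" "\<forall>e\<in>set p. h e > 0" using ps(1) flow_subgraph_awalk by blast+
      then show "card (?X p) \<le> 1" using QS h_pos by (intro cas_exit_unique[OF p(1)]) blast
    qed
    also have "\<dots> \<le> length ps" by (simp add: card_length)
    finally show ?thesis using E ps by simp
  qed
  ultimately show "length Ps \<le> width (flow_subgraph G f) s t" by simp
qed

end

section \<open>Running programs\<close>

text \<open>Total correctness with a postcondition that also sees the step count. The equations
  \<open>run_simps\<close> execute straight-line code by rewriting.\<close>

definition run :: "com \<Rightarrow> config \<Rightarrow> (nat \<Rightarrow> config \<Rightarrow> bool) \<Rightarrow> bool" where
  "run c \<sigma> Q \<longleftrightarrow> (\<exists>T \<sigma>'. exec c \<sigma> T \<sigma>' \<and> Q T \<sigma>')"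

inductive_cases exec_SkipE: "exec Skip \<sigma> T \<sigma>'"
inductive_cases exec_StoreE: "exec (Store x i a) \<sigma> T \<sigma>'"
inductive_cases exec_OutputE: "exec (Output a) \<sigma> T \<sigma>'"
inductive_cases exec_SeqE: "exec (Seq c\<^sub>1 c\<^sub>2) \<sigma> T \<sigma>'"
inductive_cases exec_CondE: "exec (Cond b c\<^sub>1 c\<^sub>2) \<sigma> T \<sigma>'"

lemma run_Skip: "run Skip \<sigma> Q \<longleftrightarrow> Q 1 \<sigma>"
  unfolding run_def by (metis exec.Skip exec_SkipE)

lemma run_Store:
  "run (Store x i a) (M, out) Q \<longleftrightarrow> Q 1 (M(x := (M x)(aval i M := aval a M)), out)"
  unfolding run_def by (metis exec.Store exec_StoreE prod.inject)

lemma run_Output: "run (Output a) (M, out) Q \<longleftrightarrow> Q 1 (M, out @ [aval a M])"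
  unfolding run_def by (metis exec.Output exec_OutputE prod.inject)

lemma run_Seq:
  "run (Seq c\<^sub>1 c\<^sub>2) \<sigma> Q \<longleftrightarrow> run c\<^sub>1 \<sigma> (\<lambda>T\<^sub>1 \<sigma>'. run c\<^sub>2 \<sigma>' (\<lambda>T\<^sub>2. Q (T\<^sub>1 + T\<^sub>2)))"
  unfolding run_def by (blast intro: exec.Seq elim!: exec_SeqE)

lemma run_Cond:
  "run (Cond b c\<^sub>1 c\<^sub>2) \<sigma> Q \<longleftrightarrow>
     (if bval b (fst \<sigma>) then run c\<^sub>1 \<sigma> (\<lambda>T. Q (T + 1)) else run c\<^sub>2 \<sigma> (\<lambda>T. Q (T + 1)))"
proof -
  have "run (Cond b c\<^sub>1 c\<^sub>2) \<sigma> Q \<longleftrightarrow> run c\<^sub>1 \<sigma> (\<lambda>T. Q (T + 1))" if "bval b (fst \<sigma>)"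
    unfolding run_def
  proof
    assume "\<exists>T \<sigma>'. exec c\<^sub>1 \<sigma> T \<sigma>' \<and> Q (T + 1) \<sigma>'"
    then show "\<exists>T \<sigma>'. exec (Cond b c\<^sub>1 c\<^sub>2) \<sigma> T \<sigma>' \<and> Q T \<sigma>'"
      using exec.CondTrue[OF that] by blast
  qed (use that in \<open>auto elim!: exec_CondE\<close>)
  moreover have "run (Cond b c\<^sub>1 c\<^sub>2) \<sigma> Q \<longleftrightarrow> run c\<^sub>2 \<sigma> (\<lambda>T. Q (T + 1))" if "\<not> bval b (fst \<sigma>)"
    unfolding run_def
  proof
    assume "\<exists>T \<sigma>'. exec c\<^sub>2 \<sigma> T \<sigma>' \<and> Q (T + 1) \<sigma>'"
    then show "\<exists>T \<sigma>'. exec (Cond b c\<^sub>1 c\<^sub>2) \<sigma> T \<sigma>' \<and> Q T \<sigma>'"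
      using exec.CondFalse[OF that] by blast
  qed (use that in \<open>auto elim!: exec_CondE\<close>)
  ultimately show ?thesis by simp
qed

lemmas run_simps = run_Skip run_Store run_Output run_Seq run_Cond

lemma run_mono: "run c \<sigma> Q \<Longrightarrow> (\<And>T \<sigma>'. Q T \<sigma>' \<Longrightarrow> Q' T \<sigma>') \<Longrightarrow> run c \<sigma> Q'"
  unfolding run_def by blast

text \<open>The first argument of \<open>I\<close> is the number of steps still paid for.\<close>

lemma run_While:
  assumes "I k \<sigma>"
    and body: "\<And>k \<sigma>. I k \<sigma> \<Longrightarrow> bval b (fst \<sigma>) \<Longrightarrow>
      run c \<sigma> (\<lambda>T \<sigma>'. \<exists>k'. I k' \<sigma>' \<and> T + 1 + k' \<le> k)"
  shows "run (While b c) \<sigma> (\<lambda>T \<sigma>'. \<not> bval b (fst \<sigma>') \<and> (\<exists>k'. I k' \<sigma>' \<and> T + k' \<le> k + 1))"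
  using assms(1)
\<comment> \<open>The step charged for each test makes the credit drop in every round, so the
  accounting also proves termination.\<close>
proof (induction k arbitrary: \<sigma> rule: less_induct)
  case (less k)
  show ?case
  proof (cases "bval b (fst \<sigma>)")
    case True
    then obtain T\<^sub>1 \<sigma>\<^sub>1 k\<^sub>1 where 1: "exec c \<sigma> T\<^sub>1 \<sigma>\<^sub>1" "I k\<^sub>1 \<sigma>\<^sub>1" "T\<^sub>1 + 1 + k\<^sub>1 \<le> k"
      using body[OF less.prems] unfolding run_def by blast
    then obtain T\<^sub>2 \<sigma>\<^sub>2 k\<^sub>2 where 2: "exec (While b c) \<sigma>\<^sub>1 T\<^sub>2 \<sigma>\<^sub>2" "\<not> bval b (fst \<sigma>\<^sub>2)"
      "I k\<^sub>2 \<sigma>\<^sub>2" "T\<^sub>2 + k\<^sub>2 \<le> k\<^sub>1 + 1"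
      using less.IH[of k\<^sub>1 \<sigma>\<^sub>1] unfolding run_def by force
    have "exec (While b c) \<sigma> (T\<^sub>1 + T\<^sub>2 + 1) \<sigma>\<^sub>2" using True 1 2 by (blast intro: exec.WhileTrue)
    moreover have "T\<^sub>1 + T\<^sub>2 + 1 + k\<^sub>2 \<le> k + 1" using 1 2 by simp
    ultimately show ?thesis unfolding run_def using 2 by blast
  next
    case False
    \<comment> \<open>The failing test is the one step beyond the credit in the conclusion.\<close>
    then have "exec (While b c) \<sigma> 1 \<sigma>" by (rule exec.WhileFalse)
    moreover have "1 + k \<le> k + 1" by simp
    ultimately show ?thesis unfolding run_def using False less.prems by blast
  qed
qed

section \<open>The algorithm\<close>

abbreviation var :: "string \<Rightarrow> aexp" where
  "var x \<equiv> Cell x (Const 0)"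

abbreviation assign :: "string \<Rightarrow> aexp \<Rightarrow> com" where
  "assign x a \<equiv> Store x (Const 0) a"

abbreviation increment :: "string \<Rightarrow> com" where
  "increment x \<equiv> assign x (Add (var x) (Const 1))"

definition Equal :: "aexp \<Rightarrow> aexp \<Rightarrow> bexp" where
  "Equal a b = BAnd (BNot (Less a b)) (BNot (Less b a))"

lemma bval_Equal [simp]: "bval (Equal a b) M \<longleftrightarrow> aval a M = aval b M"
  by (auto simp: Equal_def)

definition max_loop :: com where
  "max_loop =
     While (Less (var ''e'') (var ''m''))
       (Seq (Cond (Less (var ''max'') (Cell ''flow'' (var ''e'')))
               (assign ''max'' (Cell ''flow'' (var ''e''))) Skip)
            (increment ''e''))"

text \<open>The machine cannot halve a number, so the powers of two are tabulated by doubling and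
  the phases read the table downwards.\<close>

definition power_loop :: com where
  "power_loop =
     While (BNot (Less (var ''max'') (Cell ''pow'' (var ''i''))))
       (Seq (Store ''pow'' (Add (var ''i'') (Const 1))
               (Add (Cell ''pow'' (var ''i'')) (Cell ''pow'' (var ''i''))))
            (increment ''i''))"

definition reset_loop :: com where
  "reset_loop =
     While (Less (var ''v'') (var ''n''))
       (Seq (Store ''cur'' (var ''v'') (Const 0)) (increment ''v''))"

definition emit_loop :: com where
  "emit_loop =
     While (Less (var ''j'') (var ''len''))
       (Seq (Output (Cell ''path'' (var ''j'')))
       (Seq (Store ''flow'' (Cell ''path'' (var ''j''))
               (Sub (Cell ''flow'' (Cell ''path'' (var ''j''))) (Cell ''pow'' (var ''i''))))
            (increment ''j'')))"

text \<open>The search restarts at \<open>s\<close> but keeps all pointers \<open>cur\<close>; this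
  lets the scanning cost be charged once per phase rather than once per path.\<close>

definition emit_path :: com where
  "emit_path =
     Seq (Output (Cell ''pow'' (var ''i'')))
    (Seq (Output (var ''len''))
    (Seq (assign ''j'' (Const 0))
    (Seq emit_loop
    (Seq (assign ''v'' (var ''s''))
         (assign ''len'' (Const 0))))))"

text \<open>The pointer of the old vertex stays on the pushed edge, so that after an emission this
  edge is tested again against the lowered flow.\<close>

definition push_edge :: com where
  "push_edge =
     Seq (Store ''path'' (var ''len'') (Cell ''cur'' (var ''v'')))
    (Seq (assign ''v'' (Cell ''head'' (Cell ''cur'' (var ''v''))))
         (increment ''len''))"

definition pop_edge :: com where
  "pop_edge =
     Seq (assign ''len'' (Sub (var ''len'') (Const 1)))
    (Seq (assign ''v'' (Cell ''tail'' (Cell ''path'' (var ''len''))))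
         (Store ''cur'' (var ''v'') (Add (Cell ''cur'' (var ''v'')) (Const 1))))"

definition search_step :: com where
  "search_step =
     Cond (Equal (var ''v'') (var ''t'')) emit_path
    (Cond (Less (Cell ''cur'' (var ''v'')) (var ''m''))
       (Cond (BAnd (Equal (Cell ''tail'' (Cell ''cur'' (var ''v''))) (var ''v''))
                   (BNot (Less (Cell ''flow'' (Cell ''cur'' (var ''v''))) (Cell ''pow'' (var ''i'')))))
          push_edge
          (Store ''cur'' (var ''v'') (Add (Cell ''cur'' (var ''v'')) (Const 1))))
       pop_edge)"

text \<open>The positive sum encodes a disjunction: the stack is nonempty, or the current vertex has
  edges left to scan.\<close>

definition search_loop :: com where
  "search_loop =
     While (Less (Const 0) (Add (var ''len'') (Sub (var ''m'') (Cell ''cur'' (var ''v'')))))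
       search_step"

text \<open>\<open>power_loop\<close> leaves \<open>i\<close> at the first power above the maximum,
  so \<open>i\<close> is lowered before the search.\<close>

definition phase :: com where
  "phase =
     Seq (assign ''i'' (Sub (var ''i'') (Const 1)))
    (Seq (assign ''v'' (Const 0))
    (Seq reset_loop
    (Seq (assign ''v'' (var ''s''))
    (Seq (assign ''len'' (Const 0))
         search_loop))))"

definition phase_loop :: com where
  "phase_loop = While (Less (Const 0) (var ''i'')) phase"

definition decompose :: com where
  "decompose =
     Seq max_loop
    (Seq (assign ''pow'' (Const 1))
    (Seq power_loop phase_loop))"

section \<open>Correctness and running time\<close>

definition modifies :: "string set \<Rightarrow> memory \<Rightarrow> memory \<Rightarrow> bool" where
  "modifies X M M' \<longleftrightarrow> (\<forall>x. x \<notin> X \<longrightarrow> M' x = M x)"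

lemma modifies_refl [simp]: "modifies X M M"
  by (simp add: modifies_def)

lemma modifies_update [simp]: "modifies X M M' \<Longrightarrow> x \<in> X \<Longrightarrow> modifies X M (M'(x := a))"
  by (auto simp: modifies_def)

lemma modifiesD: "modifies X M M' \<Longrightarrow> x \<notin> X \<Longrightarrow> M' x = M x"
  by (simp add: modifies_def)

section \<open>Cost and effect of the elementary loops\<close>

lemma max_loop_run:
  assumes "M ''e'' 0 = 0" "M ''max'' 0 = 0" "M ''m'' 0 = m"
  shows "run max_loop (M, out) (\<lambda>T (M', out'). T \<le> 4 * m + 1 \<and> out' = out \<and>
    modifies {''e'', ''max''} M M' \<and> M' ''max'' 0 = Max (insert 0 (M ''flow'' ` {..<m})))"
proof -
  define mx where "mx e = Max (insert 0 (M ''flow'' ` {..<e}))" for e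
  have mx_Suc: "mx (Suc e) = max (M ''flow'' e) (mx e)" for e
    by (simp add: mx_def lessThan_Suc insert_commute[of 0])
  \<comment> \<open>A round takes four steps: the loop test, the conditional, its branch and the
    increment.\<close>
  let ?I = "\<lambda>k (M', out'). \<exists>e\<le>m. k = 4 * (m - e) \<and> M' ''e'' 0 = e \<and> out' = out \<and>
    modifies {''e'', ''max''} M M' \<and> M' ''max'' 0 = mx e"
  have "?I (4 * m) (M, out)" using assms by (auto simp: mx_def)
  then show ?thesis unfolding max_loop_def mx_def[symmetric]
  proof (rule run_mono[OF run_While[where I = ?I]], goal_cases)
    case (1 k \<sigma>)
    obtain M' out' where \<sigma>: "\<sigma> = (M', out')" by force
    from 1(1) obtain e where e: "k = 4 * (m - e)" "M' ''e'' 0 = e" "out' = out"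
      "modifies {''e'', ''max''} M M'" "M' ''max'' 0 = mx e"
      unfolding \<sigma> prod.case by blast
    then have "e < m" using 1(2) assms by (simp add: \<sigma> modifiesD)
    moreover have "M' ''flow'' = M ''flow''" using e by (simp add: modifiesD)
    ultimately show ?case using e
      by (auto simp: \<sigma> run_simps mx_Suc intro!: exI[of _ "4 * (m - Suc e)"] exI[of _ "Suc e"])
  next
    case (2 T \<sigma>')
    obtain M' out' where \<sigma>: "\<sigma>' = (M', out')" by force
    from 2 obtain e k' where e: "e \<le> m" "M' ''e'' 0 = e" "out' = out" "T + k' \<le> 4 * m + 1"
      "modifies {''e'', ''max''} M M'" "M' ''max'' 0 = mx e"
      unfolding \<sigma> prod.case by blast
    moreover from this have "e = m" using 2 assms by (simp add: \<sigma> modifiesD)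
    ultimately show ?case by (simp add: \<sigma>)
  qed
qed

text \<open>\<open>K\<close> is the binary length of \<open>x\<close>: 0 for \<open>x = 0\<close>,
  and otherwise one more than the rounded-down logarithm. It will be the number of phases.\<close>

lemma power_loop_run:
  assumes "M ''i'' 0 = 0" "M ''pow'' 0 = 1" "M ''max'' 0 = x"
  defines "K \<equiv> LEAST k. x < 2 ^ k"
  shows "run power_loop (M, out) (\<lambda>T (M', out'). T \<le> 3 * K + 1 \<and> out' = out \<and>
    modifies {''i'', ''pow''} M M' \<and> M' ''i'' 0 = K \<and> (\<forall>j\<le>K. M' ''pow'' j = 2 ^ j))"
proof -
  let ?I = "\<lambda>k (M', out'). \<exists>i\<le>K. k = 3 * (K - i) \<and> out' = out \<and>
    modifies {''i'', ''pow''} M M' \<and> M' ''i'' 0 = i \<and> (\<forall>j\<le>i. M' ''pow'' j = 2 ^ j)"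
  have K: "x < 2 ^ K" unfolding K_def by (rule LeastI_ex) (meson less_exp)
  have below_K: "2 ^ j \<le> x" if "j < K" for j
    using not_less_Least[of j] that unfolding K_def by fastforce
  have "?I (3 * K) (M, out)" using assms by auto
  then show ?thesis unfolding power_loop_def
  proof (rule run_mono[OF run_While[where I = ?I]], goal_cases)
    case (1 k \<sigma>)
    obtain M' out' where \<sigma>: "\<sigma> = (M', out')" by force
    from 1(1) obtain i where i: "i \<le> K" "k = 3 * (K - i)" "M' ''i'' 0 = i" "out' = out"
      "modifies {''i'', ''pow''} M M'" "\<forall>j\<le>i. M' ''pow'' j = 2 ^ j"
      unfolding \<sigma> prod.case by blast
    then have "2 ^ i \<le> x" using 1(2) assms(3) by (simp add: \<sigma> modifiesD)
    then have "i < K" using i K by (metis le_neq_implies_less not_le)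
    then show ?case using i
      by (auto simp: \<sigma> run_simps le_Suc_eq
          intro!: exI[of _ "3 * (K - Suc i)"] exI[of _ "Suc i"])
  next
    case (2 T \<sigma>')
    obtain M' out' where \<sigma>: "\<sigma>' = (M', out')" by force
    from 2 obtain i k' where i: "i \<le> K" "M' ''i'' 0 = i" "out' = out" "T + k' \<le> 3 * K + 1"
      "modifies {''i'', ''pow''} M M'" "\<forall>j\<le>i. M' ''pow'' j = 2 ^ j"
      unfolding \<sigma> prod.case by blast
    then have "x < 2 ^ i" using 2 assms(3) by (simp add: \<sigma> modifiesD)
    then have "i = K" using below_K[of i] i(1) by linarith
    then show ?case using i \<sigma> by simp
  qed
qed

lemma reset_loop_run:
  assumes "M ''v'' 0 = 0" "M ''n'' 0 = n"
  shows "run reset_loop (M, out) (\<lambda>T (M', out'). T \<le> 3 * n + 1 \<and> out' = out \<and>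
    modifies {''v'', ''cur''} M M' \<and> (\<forall>u<n. M' ''cur'' u = 0))"
proof -
  let ?I = "\<lambda>k (M', out'). \<exists>v\<le>n. k = 3 * (n - v) \<and> out' = out \<and>
    modifies {''v'', ''cur''} M M' \<and> M' ''v'' 0 = v \<and> (\<forall>u<v. M' ''cur'' u = 0)"
  have "?I (3 * n) (M, out)" using assms by auto
  then show ?thesis unfolding reset_loop_def
  proof (rule run_mono[OF run_While[where I = ?I]], goal_cases)
    case (1 k \<sigma>)
    obtain M' out' where \<sigma>: "\<sigma> = (M', out')" by force
    from 1(1) obtain v where v: "k = 3 * (n - v)" "M' ''v'' 0 = v" "out' = out"
      "modifies {''v'', ''cur''} M M'" "\<forall>u<v. M' ''cur'' u = 0"
      unfolding \<sigma> prod.case by blast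
    then have "v < n" using 1(2) assms by (simp add: \<sigma> modifiesD)
    then show ?case using v
      by (auto simp: \<sigma> run_simps less_Suc_eq
          intro!: exI[of _ "3 * (n - Suc v)"] exI[of _ "Suc v"])
  next
    case (2 T \<sigma>')
    obtain M' out' where \<sigma>: "\<sigma>' = (M', out')" by force
    from 2 obtain v k' where v: "v \<le> n" "M' ''v'' 0 = v" "out' = out" "T + k' \<le> 3 * n + 1"
      "modifies {''v'', ''cur''} M M'" "\<forall>u<v. M' ''cur'' u = 0"
      unfolding \<sigma> prod.case by blast
    moreover from this have "v = n" using 2 assms by (simp add: \<sigma> modifiesD)
    ultimately show ?case by (simp add: \<sigma>)
  qed
qed

lemma emit_loop_run:
  assumes "M ''j'' 0 = 0" "M ''len'' 0 = length p" "\<forall>j<length p. M ''path'' j = p ! j"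
    "M ''pow'' (M ''i'' 0) = q" "distinct p"
  shows "run emit_loop (M, out) (\<lambda>T (M', out'). T \<le> 4 * length p + 1 \<and> out' = out @ p \<and>
    modifies {''j'', ''flow''} M M' \<and>
    (\<forall>e. M' ''flow'' e = (if e \<in> set p then M ''flow'' e - q else M ''flow'' e)))"
proof -
  let ?I = "\<lambda>k (M', out'). \<exists>j\<le>length p. k = 4 * (length p - j) \<and> out' = out @ take j p \<and>
    modifies {''j'', ''flow''} M M' \<and> M' ''j'' 0 = j \<and>
    (\<forall>e. M' ''flow'' e = (if e \<in> set (take j p) then M ''flow'' e - q else M ''flow'' e))"
  have "?I (4 * length p) (M, out)" using assms by auto
  then show ?thesis unfolding emit_loop_def
  proof (rule run_mono[OF run_While[where I = ?I]], goal_cases)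
    case (1 k \<sigma>)
    obtain M' out' where \<sigma>: "\<sigma> = (M', out')" by force
    from 1(1) obtain j where j: "k = 4 * (length p - j)" "M' ''j'' 0 = j"
      "out' = out @ take j p" "modifies {''j'', ''flow''} M M'"
      "\<forall>e. M' ''flow'' e = (if e \<in> set (take j p) then M ''flow'' e - q else M ''flow'' e)"
      unfolding \<sigma> prod.case by blast
    then have less: "j < length p" using 1(2) assms by (simp add: \<sigma> modifiesD)
    \<comment> \<open>Since no edge repeats, the flow of the edge at position \<open>j\<close> has
      not been lowered yet.\<close>
    have "p ! j \<notin> set (take j p)"
      using assms(5) less by (auto simp: in_set_conv_nth nth_eq_iff_index_eq)
    moreover have "M' ''path'' j = p ! j" "M' ''pow'' (M' ''i'' 0) = q"
      using j less assms by (auto simp: modifiesD)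
    ultimately show ?case using j less
      by (auto simp: \<sigma> run_simps take_Suc_conv_app_nth
          intro!: exI[of _ "4 * (length p - Suc j)"] exI[of _ "Suc j"])
  next
    case (2 T \<sigma>')
    obtain M' out' where \<sigma>: "\<sigma>' = (M', out')" by force
    from 2 obtain j k' where j: "j \<le> length p" "M' ''j'' 0 = j" "T + k' \<le> 4 * length p + 1"
      "out' = out @ take j p" "modifies {''j'', ''flow''} M M'"
      "\<forall>e. M' ''flow'' e = (if e \<in> set (take j p) then M ''flow'' e - q else M ''flow'' e)"
      unfolding \<sigma> prod.case by blast
    moreover from this have "j = length p" using 2 assms by (simp add: \<sigma> modifiesD)
    ultimately show ?case by (simp add: \<sigma>)
  qed
qed

lemma emit_path_run:
  assumes "M ''len'' 0 = length p" "\<forall>j<length p. M ''path'' j = p ! j"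
    "M ''pow'' (M ''i'' 0) = q" "distinct p"
  shows "run emit_path (M, out) (\<lambda>T (M', out'). T \<le> 4 * length p + 6 \<and>
    out' = out @ q # length p # p \<and> M' ''v'' 0 = M ''s'' 0 \<and> M' ''len'' 0 = 0 \<and>
    modifies {''j'', ''flow'', ''v'', ''len''} M M' \<and>
    (\<forall>e. M' ''flow'' e = (if e \<in> set p then M ''flow'' e - q else M ''flow'' e)))"
proof -
  let ?M = "M(''j'' := (M ''j'')(0 := 0))"
  have "run emit_loop (?M, out @ [q, length p])
    (\<lambda>T (M', out'). T \<le> 4 * length p + 1 \<and> out' = (out @ [q, length p]) @ p \<and>
      modifies {''j'', ''flow''} ?M M' \<and>
      (\<forall>e. M' ''flow'' e = (if e \<in> set p then ?M ''flow'' e - q else ?M ''flow'' e)))"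
    using assms by (intro emit_loop_run) auto
  then have "run emit_loop (?M, out @ [q, length p])
    (\<lambda>T\<^sub>1 \<sigma>. run (Seq (assign ''v'' (var ''s'')) (assign ''len'' (Const 0))) \<sigma>
      (\<lambda>T\<^sub>2 (M', out'). 3 + T\<^sub>1 + T\<^sub>2 \<le> 4 * length p + 6 \<and>
        out' = out @ q # length p # p \<and> M' ''v'' 0 = M ''s'' 0 \<and> M' ''len'' 0 = 0 \<and>
        modifies {''j'', ''flow'', ''v'', ''len''} M M' \<and>
        (\<forall>e. M' ''flow'' e = (if e \<in> set p then M ''flow'' e - q else M ''flow'' e))))"
  proof (rule run_mono, goal_cases)
    case (1 T \<sigma>)
    obtain M' out' where \<sigma>: "\<sigma> = (M', out')" by force
    have "modifies {''j'', ''flow''} ?M M'" using 1 by (simp add: \<sigma>)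
    then have "modifies {''j'', ''flow'', ''v'', ''len''} M M'" "M' ''s'' = M ''s''"
      by (auto simp: modifies_def)
    then show ?case using 1 by (simp add: \<sigma> run_simps)
  qed
  then show ?thesis
    unfolding emit_path_def by (simp add: run_simps assms(1,3) add.assoc)
qed

lemma encode_decomposition_append [simp]:
  "encode_decomposition (D @ D') = encode_decomposition D @ encode_decomposition D'"
  by (simp add: encode_decomposition_def)

section \<open>The depth-first search of one phase\<close>

locale numbered_network = st_network G s t for G :: "(nat, nat) pre_digraph" and s t :: nat +
  assumes numbered: "numbered G"
begin

abbreviation n :: nat where "n \<equiv> card (verts G)"

abbreviation m :: nat where "m \<equiv> card (arcs G)"

lemma verts_eq: "verts G = {..<n}" and arcs_eq: "arcs G = {..<m}"
  using numbered unfolding numbered_def by simp_all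

lemma mem_verts_iff: "v \<in> verts G \<longleftrightarrow> v < n"
  by (subst verts_eq) simp

lemma mem_arcs_iff: "e \<in> arcs G \<longleftrightarrow> e < m"
  by (subst arcs_eq) simp

definition holds_graph :: "memory \<Rightarrow> bool" where
  "holds_graph M \<longleftrightarrow> M ''n'' 0 = n \<and> M ''m'' 0 = m \<and> M ''s'' 0 = s \<and> M ''t'' 0 = t \<and>
     (\<forall>e<m. M ''tail'' e = tail G e \<and> M ''head'' e = head G e)"

lemma holds_graph_modifies:
  "holds_graph M \<Longrightarrow> modifies X M M' \<Longrightarrow>
    X \<inter> {''n'', ''m'', ''s'', ''t'', ''tail'', ''head''} = {} \<Longrightarrow> holds_graph M'"
  unfolding holds_graph_def modifies_def by auto

end

text \<open>\<open>M\<^sub>0\<close> is the memory on entering the search, and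
  \<open>blocked_double\<close> is what the preceding phase achieved. The original flow
  \<open>f\<close> stays a parameter because the width bound refers to its support.\<close>

locale search_phase = numbered_network G s t for G s t +
  fixes f :: "nat \<Rightarrow> nat" and M\<^sub>0 :: memory and out\<^sub>0 :: "nat list" and q :: nat
  assumes ws: "width_stable G s t" and flow: "is_flow G s t f"
    and graph: "holds_graph M\<^sub>0" and q: "q = M\<^sub>0 ''pow'' (M\<^sub>0 ''i'' 0)" "q > 0"
    and blocked_double: "blocked (M\<^sub>0 ''flow'') (2 * q)" and s_neq_t: "s \<noteq> t"
    and below_flow: "\<And>e. e \<in> arcs G \<Longrightarrow> M\<^sub>0 ''flow'' e \<le> f e"
begin

text \<open>
  The stack \<open>p\<close> is a walk from \<open>s\<close> to the current vertex, and \<open>Ps\<close> are the paths found so far. A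
  vertex \<open>v\<close> whose pointer \<open>cur[v]\<close> has reached \<open>m\<close> cannot reach \<open>t\<close> by edges of flow at least \<open>q\<close>;
  this persists because the flow only decreases.
\<close>

definition search_state :: "nat list \<Rightarrow> nat list list \<Rightarrow> config \<Rightarrow> bool" where
  "search_state p Ps = (\<lambda>(M, out).
     modifies {''cur'', ''path'', ''len'', ''v'', ''j'', ''flow''} M\<^sub>0 M \<and>
     out = out\<^sub>0 @ encode_decomposition (map (Pair q) Ps) \<and>
     (\<forall>p\<in>set Ps. awalk s p t) \<and>
     (\<forall>e<m. M\<^sub>0 ''flow'' e = M ''flow'' e + q * length (filter (\<lambda>p. e \<in> set p) Ps)) \<and>
     awalk s p (M ''v'' 0) \<and> M ''len'' 0 = length p \<and> (\<forall>j<length p. M ''path'' j = p ! j) \<and>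
     (\<forall>e\<in>set p. q \<le> M ''flow'' e \<and> M ''cur'' (tail G e) = e) \<and>
     (\<forall>v<n. M ''cur'' v \<le> m) \<and> M ''cur'' t = 0 \<and>
     (\<forall>e<m. e < M ''cur'' (tail G e) \<and> q \<le> M ''flow'' e \<longrightarrow> M ''cur'' (head G e) = m))"

definition unscanned :: "memory \<Rightarrow> nat" where
  "unscanned M = (\<Sum>v<n. m - M ''cur'' v)"

text \<open>An amortised account of the steps left. Scanning an edge releases 16, of which a pop
  spends 8 on the freed stack place; a push releases 8. An emission releases
  \<open>12 * n + 16\<close>, enough for 8 per freed stack place and
  \<open>4 * length p + 16\<close> for the output.\<close>

definition potential :: "nat list \<Rightarrow> nat list list \<Rightarrow> memory \<Rightarrow> nat" where
  "potential p Ps M = 16 * unscanned M + 8 * (n - length p) + (12 * n + 16) * (m - length Ps)"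

lemma search_stateD:
  assumes "search_state p Ps (M, out)"
  shows "M ''n'' 0 = n" "M ''m'' 0 = m" "M ''s'' 0 = s" "M ''t'' 0 = t"
    "e < m \<Longrightarrow> M ''tail'' e = tail G e" "e < m \<Longrightarrow> M ''head'' e = head G e"
    "M ''pow'' (M ''i'' 0) = q" "M ''v'' 0 < n" "length p < n"
proof -
  have mod: "modifies {''cur'', ''path'', ''len'', ''v'', ''j'', ''flow''} M\<^sub>0 M"
    and aw: "awalk s p (M ''v'' 0)"
    using assms by (auto simp: search_state_def)
  have "holds_graph M" by (rule holds_graph_modifies[OF graph mod]) simp
  then show "M ''n'' 0 = n" "M ''m'' 0 = m" "M ''s'' 0 = s" "M ''t'' 0 = t"
    "e < m \<Longrightarrow> M ''tail'' e = tail G e" "e < m \<Longrightarrow> M ''head'' e = head G e"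
    by (simp_all add: holds_graph_def)
  show "M ''pow'' (M ''i'' 0) = q" using mod q by (simp add: modifies_def)
  show "M ''v'' 0 < n" using aw awalk_last_in_verts mem_verts_iff by blast
  show "length p < n" using aw awalk_length_less by blast
qed

lemma unscanned_advance:
  assumes "v < n" "M ''cur'' v < m" "M' ''cur'' = (M ''cur'')(v := Suc (M ''cur'' v))"
  shows "unscanned M = Suc (unscanned M')"
proof -
  have split: "(\<Sum>u<n. h u) = h v + (\<Sum>u\<in>{..<n} - {v}. h u)" for h :: "nat \<Rightarrow> nat"
    using assms(1) by (simp add: sum.remove[of "{..<n}" v])
  have "(\<Sum>u\<in>{..<n} - {v}. m - M' ''cur'' u) = (\<Sum>u\<in>{..<n} - {v}. m - M ''cur'' u)"
    using assms(3) by (intro sum.cong) auto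
  then show ?thesis
    unfolding unscanned_def using assms by (simp add: split)
qed

lemma search_advance:
  assumes st: "search_state p Ps (M, out)" and v: "M ''v'' 0 = v" "v \<noteq> t" and c: "M ''cur'' v < m"
    and skip: "tail G (M ''cur'' v) = v \<Longrightarrow> M ''flow'' (M ''cur'' v) < q"
    and M': "M' = M(''cur'' := (M ''cur'')(v := Suc (M ''cur'' v)))"
  shows "search_state p Ps (M', out)" "potential p Ps M' + 16 = potential p Ps M"
proof -
  have "awalk s p v" using st v by (simp add: search_state_def)
  \<comment> \<open>By acyclicity the end of the stack is the tail of no stacked edge, so moving its
    pointer disturbs none of their pointers.\<close>
  then have "v \<notin> tail G ` set p" by (rule awalk_end_not_tail)
  then have stack: "\<forall>e\<in>set p. M' ''cur'' (tail G e) = M ''cur'' (tail G e)" by (auto simp: M')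
  have dead: "M' ''cur'' (head G e) = m"
    if e: "e < m" "e < M' ''cur'' (tail G e)" "q \<le> M ''flow'' e" for e
  proof -
    have "e < M ''cur'' (tail G e)" using e skip by (auto simp: M' less_Suc_eq split: if_splits)
    then have "M ''cur'' (head G e) = m" using st e by (simp add: search_state_def)
    then show ?thesis using c by (auto simp: M')
  qed
  have "modifies {''cur'', ''path'', ''len'', ''v'', ''j'', ''flow''} M\<^sub>0 M'"
    using st by (simp add: search_state_def M')
  moreover have "\<forall>v<n. M' ''cur'' v \<le> m" "M' ''cur'' t = 0"
    using st c v by (auto simp: search_state_def M')
  moreover have "M' x = M x" if "x \<noteq> ''cur''" for x using that by (simp add: M')
  ultimately show "search_state p Ps (M', out)"
    using st dead stack by (simp add: search_state_def)
  have "unscanned M = Suc (unscanned M')"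
    using unscanned_advance[of v M M'] search_stateD[OF st] v c by (simp add: M')
  then show "potential p Ps M' + 16 = potential p Ps M"
    by (simp add: potential_def)
qed

lemma search_push:
  assumes st: "search_state p Ps (M, out)" and v: "M ''v'' 0 = v" and e: "M ''cur'' v = e" "e < m"
    and ok: "tail G e = v" "q \<le> M ''flow'' e"
    and M': "M' = M(''path'' := (M ''path'')(length p := e), ''v'' := (M ''v'')(0 := head G e),
      ''len'' := (M ''len'')(0 := Suc (length p)))"
  shows "search_state (p @ [e]) Ps (M', out)" "potential (p @ [e]) Ps M' + 8 = potential p Ps M"
proof -
  have "awalk s p v" using st v by (simp add: search_state_def)
  then have "awalk s (p @ [e]) (head G e)"
    using e ok by (auto simp: awalk_Cons_iff awalk_Nil_iff mem_arcs_iff)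
  moreover have "\<forall>j<length (p @ [e]). M' ''path'' j = (p @ [e]) ! j"
    using st by (auto simp: search_state_def M' nth_append less_Suc_eq)
  moreover have "modifies {''cur'', ''path'', ''len'', ''v'', ''j'', ''flow''} M\<^sub>0 M'"
    using st by (simp add: search_state_def M')
  moreover have "M' ''v'' 0 = head G e" "M' ''len'' 0 = length (p @ [e])"
    "M' ''cur'' = M ''cur''" "M' ''flow'' = M ''flow''" by (simp_all add: M')
  ultimately show st': "search_state (p @ [e]) Ps (M', out)"
    using st e ok by (simp add: search_state_def)
  have "unscanned M' = unscanned M" by (simp add: M' unscanned_def)
  then show "potential (p @ [e]) Ps M' + 8 = potential p Ps M"
    using search_stateD(9)[OF st'] by (simp add: potential_def)
qed

lemma search_pop:
  assumes st: "search_state (p @ [e]) Ps (M, out)" and v: "M ''cur'' (M ''v'' 0) = m"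
    and M': "M' = M(''len'' := (M ''len'')(0 := length p), ''v'' := (M ''v'')(0 := tail G e),
      ''cur'' := (M ''cur'')(tail G e := Suc e))"
  shows "search_state p Ps (M', out)" "potential p Ps M' + 8 = potential (p @ [e]) Ps M"
proof -
  have aw: "awalk s (p @ [e]) (M ''v'' 0)" and cur: "M ''cur'' (tail G e) = e"
    using st by (auto simp: search_state_def)
  then have e: "awalk s p (tail G e)" "M ''v'' 0 = head G e" "e < m"
    by (auto simp: awalk_Cons_iff awalk_Nil_iff mem_arcs_iff)
  have "tail G e \<notin> tail G ` set p" using e(1) by (rule awalk_end_not_tail)
  then have stack: "\<forall>e\<in>set p. M' ''cur'' (tail G e) = M ''cur'' (tail G e)"
    by (auto simp: M') (metis imageI)
  have "tail G e \<noteq> t" using e(3) tail_neq_sink mem_arcs_iff by blast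
  then have "\<forall>v<n. M' ''cur'' v \<le> m" "M' ''cur'' t = 0"
    using st e(3) by (auto simp: search_state_def M')
  moreover have "M' ''cur'' (head G a) = m"
    if a: "a < m" "a < M' ''cur'' (tail G a)" "q \<le> M ''flow'' a" for a
  proof -
    have "M ''cur'' (head G a) = m"
    \<comment> \<open>For \<open>a = e\<close> the head is the current vertex, whose pointer is
      \<open>m\<close> by hypothesis; any other such edge had been passed before the pop.\<close>
    proof (cases "a = e")
      case False
      then have "a < M ''cur'' (tail G a)" using a cur by (auto simp: M' split: if_splits)
      then show ?thesis using st a by (simp add: search_state_def)
    qed (use v e in simp)
    then show ?thesis using cur e(3) by (auto simp: M')
  qed
  moreover have "\<forall>j<length p. M' ''path'' j = p ! j"
    using st by (auto simp: search_state_def M' nth_append)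
  moreover have "modifies {''cur'', ''path'', ''len'', ''v'', ''j'', ''flow''} M\<^sub>0 M'"
    using st by (simp add: search_state_def M')
  moreover have "M' ''v'' 0 = tail G e" "M' ''len'' 0 = length p" "M' ''flow'' = M ''flow''"
    by (simp_all add: M')
  ultimately show "search_state p Ps (M', out)"
    using st e(1) stack by (simp add: search_state_def)
  have "tail G e < n" using e(1) awalk_last_in_verts mem_verts_iff by blast
  then have "unscanned M = Suc (unscanned M')"
    using unscanned_advance[of "tail G e" M M'] cur e by (simp add: M')
  then show "potential p Ps M' + 8 = potential (p @ [e]) Ps M"
    using search_stateD(9)[OF st] by (simp add: potential_def)
qed

lemma search_paths_le:
  assumes Ps: "\<forall>p\<in>set Ps. awalk s p t"
    and "\<And>e. e < m \<Longrightarrow> q * length (filter (\<lambda>p. e \<in> set p) Ps) \<le> M\<^sub>0 ''flow'' e"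
  shows "length Ps \<le> width (flow_subgraph G f) s t" "length Ps \<le> m"
proof -
  have "e \<in> arcs G \<Longrightarrow> q * length (filter (\<lambda>p. e \<in> set p) Ps) \<le> M\<^sub>0 ''flow'' e" for e
    using assms(2) mem_arcs_iff by blast
  from paths_le_width[OF ws flow blocked_double s_neq_t q(2) below_flow Ps this]
  show "length Ps \<le> width (flow_subgraph G f) s t" "length Ps \<le> m" by auto
qed

lemma search_emit:
  assumes st: "search_state p Ps (M, out)" and v: "M ''v'' 0 = t"
    and M': "modifies {''j'', ''flow'', ''v'', ''len''} M M'" "M' ''v'' 0 = s" "M' ''len'' 0 = 0"
      "\<forall>e. M' ''flow'' e = (if e \<in> set p then M ''flow'' e - q else M ''flow'' e)"
  shows "search_state [] (Ps @ [p]) (M', out @ q # length p # p)"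
    "potential [] (Ps @ [p]) M' + 4 * length p + 16 \<le> potential p Ps M"
proof -
  have aw: "awalk s p t" and ge: "\<forall>e\<in>set p. q \<le> M ''flow'' e"
    using st v by (auto simp: search_state_def)
  \<comment> \<open>Every stacked edge has flow at least \<open>q\<close>, so the truncated
    subtraction is exact.\<close>
  have fl: "M\<^sub>0 ''flow'' e = M' ''flow'' e + q * length (filter (\<lambda>p. e \<in> set p) (Ps @ [p]))"
    if "e < m" for e
    using st that M'(4) ge by (auto simp: search_state_def)
  have cur: "M' ''cur'' = M ''cur''" using M' by (simp add: modifies_def)
  have Ps: "\<forall>p\<in>set (Ps @ [p]). awalk s p t" using st aw by (auto simp: search_state_def)
  have mod: "modifies {''cur'', ''path'', ''len'', ''v'', ''j'', ''flow''} M\<^sub>0 M'"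
    using st M'(1) by (auto simp: search_state_def modifies_def)
  have less: "M' ''flow'' e \<le> M ''flow'' e" for e using M'(4) by auto
  show "search_state [] (Ps @ [p]) (M', out @ q # length p # p)"
    unfolding search_state_def
    using st fl Ps mod M'(2,3) cur le_trans[OF _ less] source_in_verts
    by (auto simp: search_state_def encode_decomposition_def awalk_Nil_iff)
  \<comment> \<open>The bound on the number of paths guarantees that \<open>m - length Ps\<close>
    really drops, although subtraction is truncated.\<close>
  have "length (Ps @ [p]) \<le> m"
    using fl by (intro search_paths_le(2)[OF Ps]) simp
  then have "m - length Ps = Suc (m - length (Ps @ [p]))" by simp
  moreover have "unscanned M' = unscanned M" by (simp add: unscanned_def cur)
  moreover have "length p < n" using search_stateD[OF st] by simp
  ultimately show "potential [] (Ps @ [p]) M' + 4 * length p + 16 \<le> potential p Ps M"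
    by (simp add: potential_def)
qed

text \<open>In each branch the potential pays for the step and for the following loop test. A push
  is tight: three conditionals, three assignments and the test use 7 of the 8 units
  released.\<close>

lemma search_step_run:
  assumes st: "search_state p Ps (M, out)" and more: "0 < length p + (m - M ''cur'' (M ''v'' 0))"
  shows "run search_step (M, out) (\<lambda>T \<sigma>. \<exists>p' Ps'. search_state p' Ps' \<sigma> \<and>
    T + 1 + potential p' Ps' (fst \<sigma>) \<le> potential p Ps M)"
proof -
  note D = search_stateD[OF st]
  define v where "v = M ''v'' 0"
  have len: "M ''len'' 0 = length p" using st by (simp add: search_state_def)
  consider (emit) "v = t" | (push) "v \<noteq> t" "M ''cur'' v < m" "tail G (M ''cur'' v) = v"
      "q \<le> M ''flow'' (M ''cur'' v)"
    | (advance) "v \<noteq> t" "M ''cur'' v < m" "tail G (M ''cur'' v) = v \<Longrightarrow> M ''flow'' (M ''cur'' v) < q"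
    | (pop) "v \<noteq> t" "\<not> M ''cur'' v < m"
    by fastforce
  then show ?thesis
  proof cases
    case emit
    have aw: "awalk s p t" and path: "\<forall>j<length p. M ''path'' j = p ! j"
      using st emit by (auto simp: search_state_def v_def)
    have "run emit_path (M, out) (\<lambda>T (M', out'). T \<le> 4 * length p + 6 \<and>
        out' = out @ q # length p # p \<and> M' ''v'' 0 = M ''s'' 0 \<and> M' ''len'' 0 = 0 \<and>
        modifies {''j'', ''flow'', ''v'', ''len''} M M' \<and>
        (\<forall>e. M' ''flow'' e = (if e \<in> set p then M ''flow'' e - q else M ''flow'' e)))"
      by (intro emit_path_run len path D awalk_distinct[OF aw])
    then have "run emit_path (M, out) (\<lambda>T \<sigma>. search_state [] (Ps @ [p]) \<sigma> \<and>
        T + 2 + potential [] (Ps @ [p]) (fst \<sigma>) \<le> potential p Ps M)"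
    proof (rule run_mono, goal_cases)
      case (1 T \<sigma>)
      obtain M' out' where \<sigma>: "\<sigma> = (M', out')" by force
      show ?case using search_emit[OF st, of M'] 1 emit D(3) by (simp add: v_def \<sigma>)
    qed
    then show ?thesis
      unfolding search_step_def using emit
      by (auto simp: run_Cond v_def D elim!: run_mono)
  next
    case push
    have "M ''head'' (M ''cur'' v) = head G (M ''cur'' v)" "M ''tail'' (M ''cur'' v) = v"
      using D push by auto
    then show ?thesis
      using push search_push[OF st v_def[symmetric] refl push(2-4) refl]
      unfolding search_step_def push_edge_def
      by (simp add: run_simps D len v_def[symmetric])
        (rule exI[of _ "p @ [M ''cur'' v]"], rule exI[of _ Ps], simp)
  next
    case advance
    have "M ''tail'' (M ''cur'' v) = tail G (M ''cur'' v)" using D advance by auto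
    then show ?thesis
      using advance search_advance[OF st v_def[symmetric] advance refl]
      unfolding search_step_def
      by (simp add: run_simps D len v_def[symmetric])
        (rule conjI, blast, rule exI[of _ p], rule exI[of _ Ps], simp)
  next
    case pop
    \<comment> \<open>With the pointer exhausted, the loop condition leaves only a nonempty
      stack.\<close>
    then have "p \<noteq> []" using more by (auto simp: v_def)
    then obtain p\<^sub>1 e where p: "p = p\<^sub>1 @ [e]" by (cases p rule: rev_cases) auto
    have cur: "M ''cur'' v = m"
      using st pop D by (auto simp: search_state_def v_def le_less)
    have e: "M ''path'' (length p\<^sub>1) = e" "M ''cur'' (tail G e) = e" "e < m"
      using st by (auto simp: search_state_def p nth_append mem_arcs_iff[symmetric])
    have "M ''tail'' e = tail G e" using D e by auto
    then show ?thesis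
      using pop e search_pop[OF st[unfolded p] cur[unfolded v_def] refl] len
      unfolding search_step_def pop_edge_def
      by (simp add: run_simps D p v_def[symmetric])
        (rule exI[of _ p\<^sub>1], rule exI[of _ Ps], simp)
  qed
qed

text \<open>Exhaustion spreads from \<open>s\<close> along edges of flow at least \<open>q\<close>.
  It cannot reach \<open>t\<close>, whose pointer is still 0, while any nonempty path gives
  \<open>m > 0\<close>.\<close>

lemma search_blocked:
  assumes st: "search_state [] Ps (M, out)" and s: "M ''cur'' (M ''v'' 0) \<ge> m"
  shows "blocked (M ''flow'') q"
proof -
  have dead: "M ''cur'' w = m"
    if "awalk u p w" "\<forall>e\<in>set p. q \<le> M ''flow'' e" "M ''cur'' u = m" for u p w
    using that
  proof (induction p arbitrary: u)
    case (Cons e p)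
    then have "e < m" "tail G e = u" "awalk (head G e) p w"
      by (auto simp: awalk_Cons_iff mem_arcs_iff)
    moreover from this have "M ''cur'' (head G e) = m"
      using st Cons.prems by (auto simp: search_state_def)
    ultimately show ?case using Cons by simp
  qed (simp add: awalk_Nil_iff)
  have "M ''v'' 0 = s" using st by (auto simp: search_state_def awalk_Nil_iff)
  then have cur: "M ''cur'' s = m"
    using st s search_stateD(8)[OF st] by (auto simp: search_state_def intro: antisym)
  show ?thesis unfolding blocked_def
  proof (intro allI impI)
    fix p assume p: "awalk s p t \<and> p \<noteq> []"
    then have "m > 0" by (auto simp: awalk_def card_gt_0_iff neq_Nil_conv)
    moreover have "M ''cur'' t = 0" using st by (simp add: search_state_def)
    ultimately show "\<exists>e\<in>set p. M ''flow'' e < q"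
      using dead[of s p t] p cur by (metis not_le less_numeral_extra(3))
  qed
qed

lemma search_loop_run:
  assumes "search_state [] [] (M, out)"
  shows "run search_loop (M, out) (\<lambda>T \<sigma>. T \<le> potential [] [] M + 1 \<and>
    (\<exists>Ps. search_state [] Ps \<sigma> \<and> blocked (fst \<sigma> ''flow'') q))"
proof -
  let ?I = "\<lambda>k \<sigma>. \<exists>p Ps. search_state p Ps \<sigma> \<and> k = potential p Ps (fst \<sigma>)"
  have "?I (potential [] [] M) (M, out)" using assms by auto
  then show ?thesis unfolding search_loop_def
  proof (rule run_mono[OF run_While[where I = ?I]], goal_cases)
    case (1 k \<sigma>)
    obtain M out where \<sigma>: "\<sigma> = (M, out)" by force
    with 1 obtain p Ps where st: "search_state p Ps (M, out)" "k = potential p Ps M" by auto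
    have "M ''len'' 0 = length p" using st(1) by (simp add: search_state_def)
    then have "0 < length p + (m - M ''cur'' (M ''v'' 0))"
      using 1(2) search_stateD[OF st(1)] by (simp add: \<sigma>)
    from search_step_run[OF st(1) this] show ?case
      unfolding \<sigma> st(2) by (rule run_mono) blast
  next
    case (2 T \<sigma>)
    obtain M out where \<sigma>: "\<sigma> = (M, out)" by force
    with 2 obtain p Ps where st: "search_state p Ps (M, out)" by auto
    have "M ''len'' 0 = length p" using st by (simp add: search_state_def)
    then have p: "p = []" "M ''cur'' (M ''v'' 0) \<ge> m"
      using 2 search_stateD[OF st] by (auto simp: \<sigma>)
    then show ?case using search_blocked st 2 by (auto simp: \<sigma>)
  qed
qed

end

lemma path_sum_const: "path_sum (map (Pair q) Ps) e = q * length (filter (\<lambda>p. e \<in> set p) Ps)"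
  by (induction Ps) auto

section \<open>The sequence of phases\<close>

context numbered_network
begin

text \<open>Here \<open>i\<close> phases are left. Blockedness at \<open>2 ^ i\<close> is what the
  next phase, with half that threshold, starts from; each of the \<open>K - i\<close> finished
  phases contributed at most width many paths.\<close>

definition phase_state :: "(nat \<Rightarrow> nat) \<Rightarrow> nat \<Rightarrow> nat \<Rightarrow> config \<Rightarrow> bool" where
  "phase_state f K i = (\<lambda>(M, out).
     holds_graph M \<and> M ''i'' 0 = i \<and> i \<le> K \<and> (\<forall>j\<le>K. M ''pow'' j = 2 ^ j) \<and>
     blocked (M ''flow'') (2 ^ i) \<and>
     (\<exists>D. out = encode_decomposition D \<and> (\<forall>(w, p) \<in> set D. awalk s p t) \<and>
        (\<forall>e<m. f e = M ''flow'' e + path_sum D e) \<and>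
        length D \<le> (K - i) * width (flow_subgraph G f) s t))"

lemma phase_run:
  assumes ws: "width_stable G s t" and flow: "is_flow G s t f" and arc: "m > 0"
    and st: "phase_state f K (Suc i) (M, out)"
  shows "run phase (M, out) (\<lambda>T \<sigma>. T \<le> 70 * (n * m) \<and> phase_state f K i \<sigma>)"
proof -
  let ?q = "2 ^ i :: nat"
  have graph: "holds_graph M" and i: "M ''i'' 0 = Suc i" "Suc i \<le> K"
    and pow: "\<forall>j\<le>K. M ''pow'' j = 2 ^ j" and bl: "blocked (M ''flow'') (2 ^ Suc i)"
    using st by (auto simp: phase_state_def)
  from st obtain D where D: "out = encode_decomposition D" "\<forall>(w, p) \<in> set D. awalk s p t"
    "\<forall>e<m. f e = M ''flow'' e + path_sum D e"
    "length D \<le> (K - Suc i) * width (flow_subgraph G f) s t"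
    by (auto simp: phase_state_def)
  have n_pos: "n > 0" using source_in_verts by (auto simp: card_gt_0_iff)
  obtain a where "a \<in> arcs G" using arc by (auto simp: card_gt_0_iff)
  then have "s \<noteq> t" by (rule source_neq_sink)
  let ?M\<^sub>1 = "M(''i'' := (M ''i'')(0 := i), ''v'' := (M ''v'')(0 := 0))"
  have "run reset_loop (?M\<^sub>1, out) (\<lambda>T (M', out'). T \<le> 3 * n + 1 \<and> out' = out \<and>
    modifies {''v'', ''cur''} ?M\<^sub>1 M' \<and> (\<forall>u<n. M' ''cur'' u = 0))"
    using graph by (intro reset_loop_run) (auto simp: holds_graph_def)
  then have "run reset_loop (?M\<^sub>1, out) (\<lambda>T\<^sub>1 \<sigma>.
    run (Seq (assign ''v'' (var ''s'')) (Seq (assign ''len'' (Const 0)) search_loop)) \<sigma>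
      (\<lambda>T\<^sub>2 \<sigma>'. 2 + T\<^sub>1 + T\<^sub>2 \<le> 70 * (n * m) \<and> phase_state f K i \<sigma>'))"
  proof (rule run_mono, goal_cases)
    case (1 T \<sigma>)
    obtain M\<^sub>2 where \<sigma>: "\<sigma> = (M\<^sub>2, out)" and T: "T \<le> 3 * n + 1"
      and mod: "modifies {''v'', ''cur''} ?M\<^sub>1 M\<^sub>2" and cur: "\<forall>u<n. M\<^sub>2 ''cur'' u = 0"
      using 1 by auto
    define M\<^sub>0 where "M\<^sub>0 = M\<^sub>2(''v'' := (M\<^sub>2 ''v'')(0 := s), ''len'' := (M\<^sub>2 ''len'')(0 := 0))"
    have mod': "modifies {''i'', ''v'', ''cur'', ''len''} M M\<^sub>0"
      using mod by (auto simp: modifies_def M\<^sub>0_def)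
    have graph': "holds_graph M\<^sub>0" by (rule holds_graph_modifies[OF graph mod']) simp
    have same: "M\<^sub>0 ''flow'' = M ''flow''" "M\<^sub>0 ''pow'' = M ''pow''"
      using mod' by (simp_all add: modifiesD)
    have i': "M\<^sub>0 ''i'' 0 = i" using mod by (simp add: M\<^sub>0_def modifiesD)
    have s': "M\<^sub>2 ''s'' 0 = s" using mod graph by (simp add: modifiesD holds_graph_def)
    \<comment> \<open>Blockedness at \<open>2 ^ Suc i\<close> is \<open>blocked_double\<close> for
      \<open>?q\<close>, and the current flow lies below \<open>f\<close> because \<open>f\<close>
      exceeds it by a path sum.\<close>
    interpret search_phase G s t f M\<^sub>0 out ?q
      using ws flow graph' i' same pow i bl \<open>s \<noteq> t\<close> D(3) mem_arcs_iff
      by unfold_locales simp_all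
    have "t < n" using sink_in_verts mem_verts_iff by blast
    moreover have "M\<^sub>0 ''cur'' = M\<^sub>2 ''cur''" "M\<^sub>0 ''v'' 0 = s" "M\<^sub>0 ''len'' 0 = 0"
      by (simp_all add: M\<^sub>0_def)
    moreover have "tail G e < n" if "e < m" for e
      using that mem_arcs_iff mem_verts_iff tail_in_verts by blast
    ultimately have start: "search_state [] [] (M\<^sub>0, out)"
      using cur source_in_verts
      by (simp add: search_state_def encode_decomposition_def awalk_Nil_iff)
    have "potential [] [] M\<^sub>0 = 16 * (n * m) + 8 * n + (12 * n + 16) * m"
      using cur by (simp add: potential_def unscanned_def M\<^sub>0_def)
    \<comment> \<open>As \<open>n\<close> and \<open>m\<close> are positive, each term is bounded by
      a multiple of \<open>n * m\<close>; the coefficients add up to 28 + 8 + 16 + 3 + 1 + 5 = 61,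
      below 70.\<close>
    moreover have "n * 1 \<le> n * m" "1 * m \<le> n * m" "1 * 1 \<le> n * m"
      using arc n_pos by (intro mult_le_mono; simp)+
    moreover have "(12 * n + 16) * m = 12 * (n * m) + 16 * m" by (simp add: algebra_simps)
    ultimately have time: "T + potential [] [] M\<^sub>0 + 5 \<le> 70 * (n * m)"
      using T by linarith
    from search_loop_run[OF start]
    have "run search_loop (M\<^sub>0, out) (\<lambda>T\<^sub>2 \<sigma>'. T + T\<^sub>2 + 4 \<le> 70 * (n * m) \<and> phase_state f K i \<sigma>')"
    proof (rule run_mono, goal_cases)
      case (1 T\<^sub>2 \<sigma>')
      obtain M' out' where \<sigma>': "\<sigma>' = (M', out')" by force
      with 1 obtain Ps where T\<^sub>2: "T\<^sub>2 \<le> potential [] [] M\<^sub>0 + 1" and Ps: "search_state [] Ps (M', out')"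
        and bl': "blocked (M' ''flow'') ?q" by auto
      have mod'': "modifies {''cur'', ''path'', ''len'', ''v'', ''j'', ''flow''} M\<^sub>0 M'"
        and out': "out' = out @ encode_decomposition (map (Pair ?q) Ps)"
        and walks: "\<forall>p\<in>set Ps. awalk s p t"
        and fl: "\<forall>e<m. M\<^sub>0 ''flow'' e = M' ''flow'' e + ?q * length (filter (\<lambda>p. e \<in> set p) Ps)"
        using Ps by (simp_all add: search_state_def)
      have "holds_graph M'" by (rule holds_graph_modifies[OF graph' mod'']) simp
      moreover have "M' ''i'' 0 = i" "M' ''pow'' = M ''pow''"
        using mod'' i' same by (simp_all add: modifiesD)
      moreover have "length Ps \<le> width (flow_subgraph G f) s t"
        using fl by (intro search_paths_le(1)[OF walks]) simp
      then have "length (D @ map (Pair ?q) Ps) \<le> (K - i) * width (flow_subgraph G f) s t"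
        using D(4) i(2) by (simp add: Suc_diff_Suc[symmetric])
      moreover have "f e = M' ''flow'' e + path_sum (D @ map (Pair ?q) Ps) e" if "e < m" for e
        using D(3) fl same that by (simp add: path_sum_const)
      moreover have "\<forall>(w, p) \<in> set (D @ map (Pair ?q) Ps). awalk s p t" using D(2) walks by auto
      moreover have "out' = encode_decomposition (D @ map (Pair ?q) Ps)" using out' D(1) by simp
      ultimately have "phase_state f K i \<sigma>'"
        using pow i bl' unfolding phase_state_def \<sigma>' prod.case by (metis Suc_leD)
      then show ?case using T\<^sub>2 time by simp
    qed
    then show ?case
      by (simp add: \<sigma> run_Seq run_Store s' M\<^sub>0_def[symmetric])
        (erule run_mono, simp)
  qed
  then show ?thesis
    unfolding phase_def by (simp add: run_Seq run_Store i)
qed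

lemma phase_loop_run:
  assumes ws: "width_stable G s t" and flow: "is_flow G s t f" and arc: "K > 0 \<Longrightarrow> m > 0"
    and st: "phase_state f K K (M, out)"
  shows "run phase_loop (M, out) (\<lambda>T \<sigma>. T \<le> K * (70 * (n * m) + 1) + 1 \<and> phase_state f K 0 \<sigma>)"
proof -
  let ?I = "\<lambda>k \<sigma>. \<exists>i. phase_state f K i \<sigma> \<and> k = i * (70 * (n * m) + 1)"
  have "?I (K * (70 * (n * m) + 1)) (M, out)" using st by blast
  then show ?thesis unfolding phase_loop_def
  proof (rule run_mono[OF run_While[where I = ?I]], goal_cases)
    case (1 k \<sigma>)
    obtain M out where \<sigma>: "\<sigma> = (M, out)" by force
    from 1(1) obtain i where i: "phase_state f K i (M, out)" "k = i * (70 * (n * m) + 1)"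
      unfolding \<sigma> by blast
    have "M ''i'' 0 = i" "i \<le> K" using i(1) by (simp_all add: phase_state_def)
    with 1(2) have "i > 0" "K > 0" by (simp_all add: \<sigma>)
    then obtain i' where i': "i = Suc i'" using gr0_implies_Suc by blast
    show ?case unfolding \<sigma>
      by (rule run_mono[OF phase_run[OF ws flow arc[OF \<open>K > 0\<close>] i(1)[unfolded i']]])
        (rule exI[of _ "i' * (70 * (n * m) + 1)"], auto simp: i i')
  next
    case (2 T \<sigma>)
    obtain M out where \<sigma>: "\<sigma> = (M, out)" by force
    from 2 obtain i k' where i: "phase_state f K i (M, out)" "T + k' \<le> K * (70 * (n * m) + 1) + 1"
      unfolding \<sigma> by blast
    have "M ''i'' 0 = i" using i(1) by (simp add: phase_state_def)
    with 2 have "i = 0" by (simp add: \<sigma>)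
    then show ?case using i by (simp add: \<sigma>)
  qed
qed

lemma decompose_run:
  assumes ws: "width_stable G s t" and flow: "is_flow G s t f"
  defines "K \<equiv> LEAST k. flow_norm G f < 2 ^ k"
  shows "run decompose (input_memory G s t f, [])
    (\<lambda>T \<sigma>. T \<le> 4 * m + 3 * K + K * (70 * (n * m) + 1) + 4 \<and> phase_state f K 0 \<sigma>)"
proof -
  let ?M = "input_memory G s t f"
  have arr: "?M ''flow'' = edge_array G f" by (simp add: input_memory_def)
  have norm: "Max (insert 0 (?M ''flow'' ` {..<m})) = flow_norm G f"
    unfolding flow_norm_def arr arcs_eq[symmetric]
    by (rule arg_cong[of _ _ "\<lambda>X. Max (insert 0 X)"]) (auto simp: edge_array_def)
  have K: "flow_norm G f < 2 ^ K" unfolding K_def by (rule LeastI_ex) (meson less_exp)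
  \<comment> \<open>Without arcs the norm is 0 and no phase runs, so the estimate of a phase by
    \<open>n * m\<close> is only applied to a graph with arcs.\<close>
  have arc: "m > 0" if "K > 0"
  proof (rule ccontr)
    assume "\<not> m > 0"
    then have "arcs G = {}" by simp
    then have "flow_norm G f < 2 ^ 0" by (simp add: flow_norm_def)
    then have "K \<le> 0" unfolding K_def by (rule Least_le)
    then show False using that by simp
  qed
  have f_le: "f e < 2 ^ K" if "e \<in> arcs G" for e
    using that K finite_arcs by (intro le_less_trans[OF _ K]) (simp add: flow_norm_def)
  have graph: "holds_graph ?M"
    by (auto simp: holds_graph_def input_memory_def scalar_def edge_array_def mem_arcs_iff)
  have "run max_loop (?M, []) (\<lambda>T (M', out'). T \<le> 4 * m + 1 \<and> out' = [] \<and>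
    modifies {''e'', ''max''} ?M M' \<and> M' ''max'' 0 = flow_norm G f)"
    unfolding norm[symmetric]
    by (rule max_loop_run) (simp_all add: input_memory_def scalar_def)
  then have "run max_loop (?M, [])
    (\<lambda>T\<^sub>1 \<sigma>. run (Seq (assign ''pow'' (Const 1)) (Seq power_loop phase_loop)) \<sigma>
      (\<lambda>T\<^sub>2 \<sigma>'. T\<^sub>1 + T\<^sub>2 \<le> 4 * m + 3 * K + K * (70 * (n * m) + 1) + 4 \<and> phase_state f K 0 \<sigma>'))"
  proof (rule run_mono, goal_cases)
    case (1 T\<^sub>1 \<sigma>)
    then obtain M\<^sub>1 where \<sigma>: "\<sigma> = (M\<^sub>1, [])" and T\<^sub>1: "T\<^sub>1 \<le> 4 * m + 1"
      and mod\<^sub>1: "modifies {''e'', ''max''} ?M M\<^sub>1" and mx: "M\<^sub>1 ''max'' 0 = flow_norm G f"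
      by auto
    let ?M\<^sub>2 = "M\<^sub>1(''pow'' := (M\<^sub>1 ''pow'')(0 := 1))"
    have "?M\<^sub>2 ''i'' 0 = 0" using mod\<^sub>1 by (simp add: modifiesD input_memory_def)
    then have "run power_loop (?M\<^sub>2, []) (\<lambda>T (M', out'). T \<le> 3 * K + 1 \<and> out' = [] \<and>
      modifies {''i'', ''pow''} ?M\<^sub>2 M' \<and> M' ''i'' 0 = K \<and> (\<forall>j\<le>K. M' ''pow'' j = 2 ^ j))"
      unfolding K_def using mx by (intro power_loop_run) simp_all
    then have "run power_loop (?M\<^sub>2, []) (\<lambda>T \<sigma>'. run phase_loop \<sigma>'
      (\<lambda>T' \<sigma>''. T\<^sub>1 + (1 + (T + T')) \<le> 4 * m + 3 * K + K * (70 * (n * m) + 1) + 4 \<and>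
        phase_state f K 0 \<sigma>''))"
    proof (rule run_mono, goal_cases)
      case (1 T \<sigma>')
      then obtain M\<^sub>3 where \<sigma>': "\<sigma>' = (M\<^sub>3, [])" and T: "T \<le> 3 * K + 1"
        and mod\<^sub>3: "modifies {''i'', ''pow''} ?M\<^sub>2 M\<^sub>3" and i: "M\<^sub>3 ''i'' 0 = K"
        and pow: "\<forall>j\<le>K. M\<^sub>3 ''pow'' j = 2 ^ j"
        by auto
      have mod: "modifies {''e'', ''max'', ''i'', ''pow''} ?M M\<^sub>3"
        using mod\<^sub>1 mod\<^sub>3 by (auto simp: modifies_def)
      have graph': "holds_graph M\<^sub>3" by (rule holds_graph_modifies[OF graph mod]) simp
      have fl: "M\<^sub>3 ''flow'' e = f e" if "e < m" for e
        using mod that by (simp add: modifiesD arr edge_array_def mem_arcs_iff)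
      have "blocked (M\<^sub>3 ''flow'') (2 ^ K)" unfolding blocked_def
      proof (intro allI impI)
        fix p assume "awalk s p t \<and> p \<noteq> []"
        then obtain e where "e \<in> set p" "e \<in> arcs G" by (metis awalkE list.set_sel(1) subsetD)
        then show "\<exists>e\<in>set p. M\<^sub>3 ''flow'' e < 2 ^ K" using f_le fl mem_arcs_iff by metis
      qed
      then have "phase_state f K K (M\<^sub>3, [])"
        using graph' i pow fl
        by (auto simp: phase_state_def encode_decomposition_def intro!: exI[of _ "[]"])
      from phase_loop_run[OF ws flow arc this] show ?case
        unfolding \<sigma>' by (rule run_mono) (use T T\<^sub>1 in auto)
    qed
    then show ?case by (simp add: \<sigma> run_Seq run_Store)
  qed
  then show ?thesis unfolding decompose_def by (simp add: run_Seq)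
qed

text \<open>After the phase with \<open>q = 1\<close> no path of positive flow is left. The
  remainder is still a flow, so it vanishes by \<open>positive_flow_path\<close>, and the emitted
  paths decompose \<open>f\<close> exactly.\<close>

lemma phase_state_final:
  assumes flow: "is_flow G s t f" and st: "phase_state f K 0 (M, out)"
  obtains D where "out = encode_decomposition D" "flow_decomposition G s t f D"
    "length D \<le> K * mfd G s t f"
proof -
  have bl: "blocked (M ''flow'') 1" using st by (simp add: phase_state_def)
  from st obtain D where D: "out = encode_decomposition D" "\<forall>(w, p) \<in> set D. awalk s p t"
    "\<forall>e<m. f e = M ''flow'' e + path_sum D e" "length D \<le> K * width (flow_subgraph G f) s t"
    by (auto simp: phase_state_def)
  have "is_flow G s t (\<lambda>e. M ''flow'' e + path_sum D e)"
    using flow D(3) by (subst is_flow_cong[of G _ f]) (auto simp: mem_arcs_iff)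
  then have "is_flow G s t (M ''flow'')"
    using path_sum_is_flow[OF D(2)] by (rule is_flow_cancel)
  then have "M ''flow'' e = 0" if "e \<in> arcs G" for e
    using positive_flow_path[of "M ''flow''" e] that bl unfolding blocked_def
    by (metis gr0I less_one not_less_zero)
  then have dec: "flow_decomposition G s t f D"
    using D(2,3) by (simp add: flow_decomposition_iff mem_arcs_iff)
  then have "width (flow_subgraph G f) s t \<le> mfd G s t f" by (intro width_le_mfd) blast
  then have "length D \<le> K * mfd G s t f" using D(4) by (meson le_trans mult_le_mono2)
  then show thesis using that D(1) dec by blast
qed

end

section \<open>Final bounds in terms of the logarithm\<close>

lemma decompose_correct:
  assumes "numbered G" "st_dag G s t" "width_stable G s t" "is_flow G s t f"
  shows "\<exists>T M D.
    exec decompose (input_memory G s t f, []) T (M, encode_decomposition D) \<and>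
    flow_decomposition G s t f D \<and>
    int (length D) \<le> (\<lfloor>log 2 (real (flow_norm G f))\<rfloor> + 1) * int (mfd G s t f) \<and>
    real T \<le> 160 * max 1 (real (card (verts G)) * max 1 (log 2 (real (flow_norm G f))) *
                        (real (width G s t) + real (card (arcs G))))"
proof -
  interpret numbered_network G s t using assms by unfold_locales
  define x where "x = flow_norm G f"
  define K where "K = (LEAST k. x < 2 ^ k)"
  define l where "l = max 1 (log 2 (real x))"
  from decompose_run[OF assms(3,4)] obtain T M out
    where ex: "exec decompose (input_memory G s t f, []) T (M, out)"
      and T: "T \<le> 4 * m + 3 * K + K * (70 * (n * m) + 1) + 4" and st: "phase_state f K 0 (M, out)"
    unfolding run_def K_def x_def by (metis surj_pair)
  from phase_state_final[OF assms(4) st] obtain D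
    where D: "out = encode_decomposition D" "flow_decomposition G s t f D"
      "length D \<le> K * mfd G s t f" by blast
  have K_le: "real K - 1 \<le> log 2 (real x)" if "K > 0"
  proof -
    have "\<not> x < 2 ^ (K - 1)" using not_less_Least[of "K - 1" "\<lambda>k. x < 2 ^ k"] that K_def by simp
    then have "2 ^ (K - 1) \<le> real x" by (metis linorder_not_less of_nat_le_iff of_nat_numeral of_nat_power)
    then have "real (K - 1) \<le> log 2 (real x)" by (intro le_log_of_power) auto
    then show ?thesis using that by (simp add: of_nat_diff)
  qed
  have "int (length D) \<le> (\<lfloor>log 2 (real x)\<rfloor> + 1) * int (mfd G s t f)"
  proof (cases "K > 0")
    case True
    then have "int K \<le> \<lfloor>log 2 (real x)\<rfloor> + 1" using K_le by linarith
    then have "int K * int (mfd G s t f) \<le> (\<lfloor>log 2 (real x)\<rfloor> + 1) * int (mfd G s t f)"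
      by (intro mult_right_mono) auto
    moreover have "int (length D) \<le> int K * int (mfd G s t f)"
      using D(3) by (metis of_nat_le_iff of_nat_mult)
    ultimately show ?thesis by linarith
  next
    case False
    \<comment> \<open>Here \<open>x = 0\<close> and \<open>D\<close> is empty; the default value
      \<open>log 2 0 = 0\<close> keeps the right-hand side nonnegative.\<close>
    have "0 \<le> log 2 (real x)" by (cases "x = 0") (auto simp: log_def)
    then show ?thesis using False D(3) by simp
  qed
  moreover have "real T \<le> 160 * max 1 (real n * l * (real (width G s t) + real m))"
  proof (cases "m = 0")
    case True
    then have "x = 0" unfolding x_def flow_norm_def by simp
    then have "K \<le> 0" unfolding K_def by (intro Least_le) simp
    then have "T \<le> 4" using T True by simp
    \<comment> \<open>The outer \<open>max 1\<close> absorbs the constant number of steps spent on a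
      graph without edges.\<close>
    moreover have "1 \<le> max 1 (real n * l * (real (width G s t) + real m))" by simp
    ultimately show ?thesis by linarith
  next
    case False
    let ?X = "real n * l * real m"
    have "n > 0" using source_in_verts by (auto simp: card_gt_0_iff)
    then have n1: "1 \<le> real n" by linarith
    have m1: "1 \<le> real m" using False by linarith
    have l1: "1 \<le> l" by (simp add: l_def)
    \<comment> \<open>There are at most \<open>log 2 x + 1\<close> phases; the inner
      \<open>max 1\<close> in \<open>l\<close> covers norm 1, where the logarithm vanishes but one
      phase runs.\<close>
    have K2: "real K \<le> 2 * l"
    proof (cases "K > 0")
      case True
      then show ?thesis using K_le unfolding l_def by linarith
    qed (use l1 in simp)
    have nl: "1 \<le> real n * l" using mult_mono[OF n1 l1] by simp
    have nm: "1 \<le> real n * real m" using mult_mono[OF n1 m1] by simp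
    have "real m \<le> ?X" using mult_right_mono[OF nl, of "real m"] by simp
    moreover have "l \<le> ?X" using mult_right_mono[OF nm, of l] l1 by (simp add: mult_ac)
    moreover have "real K * (real n * real m) \<le> 2 * ?X"
      using mult_right_mono[OF K2, of "real n * real m"] by (simp add: mult_ac)
    moreover have "real T \<le> 4 * real m + 3 * real K + (70 * (real K * (real n * real m)) + real K) + 4"
    proof -
      have "real T \<le> real (4 * m + 3 * K + K * (70 * (n * m) + 1) + 4)" using T by (simp only: of_nat_le_iff)
      then show ?thesis by (simp add: algebra_simps)
    qed
    moreover have "?X \<le> real n * l * (real (width G s t) + real m)"
      using nl by (intro mult_left_mono) auto
    \<comment> \<open>The terms give at most 4 + 8 + 140 times \<open>?X\<close>, plus 4, which
      stays below the constant 160.\<close>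
    ultimately show ?thesis using K2 l1 by linarith
  qed
  ultimately show ?thesis using ex D(1,2) unfolding l_def x_def by blast
qed

theorem theorem3:
  shows "\<exists>(P :: com) (C :: real).
    \<forall>(G :: (nat, nat) pre_digraph) (s :: nat) (t :: nat) (f :: nat \<Rightarrow> nat).
      numbered G \<and> st_dag G s t \<and> width_stable G s t \<and> is_flow G s t f \<longrightarrow>
      (\<exists>T M D.
         exec P (input_memory G s t f, []) T (M, encode_decomposition D) \<and>
         flow_decomposition G s t f D \<and>
         int (length D) \<le> (\<lfloor>log 2 (real (flow_norm G f))\<rfloor> + 1) * int (mfd G s t f) \<and>
         real T \<le> C * max 1 (real (card (verts G)) * max 1 (log 2 (real (flow_norm G f))) *
                              (real (width G s t) + real (card (arcs G)))))"
  using decompose_correct by blast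

end
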